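(* Let $b\in\mathbb{R}$ and $\lambda>0$ be constants, let ${\rm w}(t)$, $t\geqslant 0$, be a one-dimensional Wiener process, and let $N(t)$, $t\geqslant0$, be a process independent of ${\rm w}$ such that $N(t)/\pi$ is a homogeneous (stationary) Poisson process with intensity $\lambda$ and $N(0)=0$. Put $\tilde\chi(t)=\tfrac12(1+\cos N(t))$ and let $(x(t),y(t))$ be the process with $x(0)=y(0)=0$ and $$dx(t)=\tilde\chi(t)\,b\,d{\rm w}(t),\qquad dy(t)=(1-\tilde\chi(t))\,b\,d{\rm w}(t).$$ For $\alpha,\beta\in\mathbb{R}$ let $$J(t)=E\Bigl[\exp\Bigl\{i\alpha\int_0^t\tfrac12(1+\cos N(\tau))\,b\,d{\rm w}(\tau)+i\beta\int_0^t\tfrac12(1-\cos N(\tau))\,b\,d{\rm w}(\tau)\Bigr\}\Bigr]$$ be the characteristic function of $(x(t),y(t))$. Then for all $\alpha,\beta\in\mathbb{R}$, $J$ satisfies, as a function of $t\geqslant 0$, the equation $$\frac{d^{2}J(t)}{dt^{2}}+\frac12\Bigl(4\lambda+[\alpha^{2}+\beta^{2}]b^{2}\Bigr)\frac{dJ(t)}{dt}+\frac12\Bigl(\lambda\alpha^{2}+\tfrac12\alpha^{2}\beta^{2}b^{2}+\lambda\beta^{2}\Bigr)b^{2}J(t)=0 .$$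
   Context: $E$ denotes mathematical expectation. Since $N(t)$ takes values in $\pi\mathbb{Z}_{\geqslant 0}$, $\cos N(t)\in\{1,-1\}$ and $\tilde\chi(t)\in\{0,1\}$; thus the diffusion takes place at each time either in the $x$-direction or in the $y$-direction, switching at the jump times of $N$. The stochastic integrals are It\^o integrals with respect to ${\rm w}$. Derivatives at $t=0$ are one-sided. *)

theory Defs
  imports "HOL-Probability.Probability"
begin

text \<open>
  Stochastic processes with time set \<open>[0, \<infinity>)\<close> are modelled as functions \<open>real \<Rightarrow> 'a \<Rightarrow> 'b\<close> whose
  values at negative times are never used.
\<close>

definition indep_increments :: "'a measure \<Rightarrow> (real \<Rightarrow> 'a \<Rightarrow> real) \<Rightarrow> bool" where
  "indep_increments M X \<longleftrightarrow>
     (\<forall>(n::nat) t. 0 \<le> t 0 \<longrightarrow> (\<forall>i<n. t i \<le> t (Suc i)) \<longrightarrow>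
        prob_space.indep_vars M (\<lambda>_. borel) (\<lambda>i \<omega>. X (t (Suc i)) \<omega> - X (t i) \<omega>) {..<n})"

definition wiener_process :: "'a measure \<Rightarrow> (real \<Rightarrow> 'a \<Rightarrow> real) \<Rightarrow> bool" where
  "wiener_process M W \<longleftrightarrow>
     (\<forall>t\<ge>0. W t \<in> borel_measurable M) \<and>
     (AE \<omega> in M. W 0 \<omega> = 0) \<and>
     indep_increments M W \<and>
     (\<forall>s t. 0 \<le> s \<longrightarrow> s < t \<longrightarrow>
        distributed M lborel (\<lambda>\<omega>. W t \<omega> - W s \<omega>) (normal_density 0 (sqrt (t - s)))) \<and>
     (AE \<omega> in M. continuous_on {0..} (\<lambda>t. W t \<omega>))"

definition poisson_process :: "'a measure \<Rightarrow> real \<Rightarrow> (real \<Rightarrow> 'a \<Rightarrow> real) \<Rightarrow> bool" where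
  "poisson_process M lam P \<longleftrightarrow>
     (\<forall>t\<ge>0. P t \<in> borel_measurable M) \<and>
     (AE \<omega> in M. P 0 \<omega> = 0) \<and>
     indep_increments M P \<and>
     (\<forall>s t. 0 \<le> s \<longrightarrow> s < t \<longrightarrow>
        distr M borel (\<lambda>\<omega>. P t \<omega> - P s \<omega>) =
        distr (measure_pmf (poisson_pmf (lam * (t - s)))) borel real) \<and>
     (AE \<omega> in M. (\<forall>t\<ge>0. P t \<omega> \<in> \<nat>) \<and> mono_on {0..} (\<lambda>t. P t \<omega>) \<and>
        (\<forall>t\<ge>0. continuous (at_right t) (\<lambda>s. P s \<omega>)))"

definition indep_processes ::
  "'a measure \<Rightarrow> (real \<Rightarrow> 'a \<Rightarrow> real) \<Rightarrow> (real \<Rightarrow> 'a \<Rightarrow> real) \<Rightarrow> bool" where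
  "indep_processes M X Y \<longleftrightarrow>
     prob_space.indep_var M
       (\<Pi>\<^sub>M t\<in>{0..}. borel) (\<lambda>\<omega>. \<lambda>t\<in>{0..}. X t \<omega>)
       (\<Pi>\<^sub>M t\<in>{0..}. borel) (\<lambda>\<omega>. \<lambda>t\<in>{0..}. Y t \<omega>)"

definition natural_filtration ::
  "'a measure \<Rightarrow> (real \<Rightarrow> 'a \<Rightarrow> 'b::topological_space) \<Rightarrow> real \<Rightarrow> 'a measure" where
  "natural_filtration M X t =
     sigma (space M) (\<Union>s\<in>{0..t}. {X s -` A \<inter> space M | A. A \<in> sets borel})"

text \<open>
  A simple process on \<open>[0, T]\<close> is given by a partition \<open>0 = p 0 \<le> \<dots> \<le> p n = T\<close> and bounded random
  variables \<open>\<xi> i\<close>, known at time \<open>p i\<close>, that are its values on \<open>(p i, p (i + 1)]\<close>.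
\<close>

definition simple_adapted ::
  "(real \<Rightarrow> 'a measure) \<Rightarrow> real \<Rightarrow> nat \<Rightarrow> (nat \<Rightarrow> real) \<Rightarrow> (nat \<Rightarrow> 'a \<Rightarrow> real) \<Rightarrow> bool" where
  "simple_adapted F T n p \<xi> \<longleftrightarrow>
     p 0 = 0 \<and> p n = T \<and> (\<forall>i<n. p i \<le> p (Suc i)) \<and>
     (\<forall>i<n. \<xi> i \<in> borel_measurable (F (p i)) \<and> (\<exists>C. \<forall>\<omega>\<in>space (F (p i)). \<bar>\<xi> i \<omega>\<bar> \<le> C))"

definition simple_process ::
  "nat \<Rightarrow> (nat \<Rightarrow> real) \<Rightarrow> (nat \<Rightarrow> 'a \<Rightarrow> real) \<Rightarrow> real \<Rightarrow> 'a \<Rightarrow> real" where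
  "simple_process n p \<xi> s \<omega> = (\<Sum>i<n. \<xi> i \<omega> * indicator {p i<..p (Suc i)} s)"

definition simple_ito_integral ::
  "(real \<Rightarrow> 'a \<Rightarrow> real) \<Rightarrow> nat \<Rightarrow> (nat \<Rightarrow> real) \<Rightarrow> (nat \<Rightarrow> 'a \<Rightarrow> real) \<Rightarrow> 'a \<Rightarrow> real" where
  "simple_ito_integral W n p \<xi> \<omega> = (\<Sum>i<n. \<xi> i \<omega> * (W (p (Suc i)) \<omega> - W (p i) \<omega>))"

text \<open>
  \<open>X\<close> is a version of the Ito integral of \<open>f\<close> over \<open>[0, T]\<close> with respect to \<open>W\<close>: the \<open>L\<^sup>2\<close> limit of
  the integrals of simple processes approximating \<open>f\<close> in \<open>L\<^sup>2\<close>. This is meaningful when \<open>W\<close> is a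
  Wiener process relative to the filtration \<open>F\<close>, and determines \<open>X\<close> up to a null set.
\<close>

definition has_ito_integral ::
  "'a measure \<Rightarrow> (real \<Rightarrow> 'a measure) \<Rightarrow> (real \<Rightarrow> 'a \<Rightarrow> real) \<Rightarrow> real \<Rightarrow>
   (real \<Rightarrow> 'a \<Rightarrow> real) \<Rightarrow> ('a \<Rightarrow> real) \<Rightarrow> bool" where
  "has_ito_integral M F W T f X \<longleftrightarrow>
     (\<lambda>(s, \<omega>). f s \<omega>) \<in> borel_measurable (restrict_space borel {0..T} \<Otimes>\<^sub>M M) \<and>
     (\<forall>s\<in>{0..T}. f s \<in> borel_measurable (F s)) \<and>
     X \<in> borel_measurable M \<and>
     (\<exists>n p \<xi>. (\<forall>k::nat. simple_adapted F T (n k) (p k) (\<xi> k)) \<and>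
        (\<lambda>k. \<integral>\<^sup>+\<omega>. (\<integral>\<^sup>+s\<in>{0..T}.
           ennreal ((simple_process (n k) (p k) (\<xi> k) s \<omega> - f s \<omega>)\<^sup>2) \<partial>lborel) \<partial>M) \<longlonglongrightarrow> 0 \<and>
        (\<lambda>k. \<integral>\<^sup>+\<omega>. ennreal ((simple_ito_integral W (n k) (p k) (\<xi> k) \<omega> - X \<omega>)\<^sup>2) \<partial>M) \<longlonglongrightarrow> 0)"

text \<open>The stochastic differential \<open>dX = f dW\<close>.\<close>

definition has_ito_differential ::
  "'a measure \<Rightarrow> (real \<Rightarrow> 'a measure) \<Rightarrow> (real \<Rightarrow> 'a \<Rightarrow> real) \<Rightarrow>
   (real \<Rightarrow> 'a \<Rightarrow> real) \<Rightarrow> (real \<Rightarrow> 'a \<Rightarrow> real) \<Rightarrow> bool" where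
  "has_ito_differential M F W X f \<longleftrightarrow>
     (\<forall>t\<ge>0. X t \<in> borel_measurable M) \<and>
     (\<forall>t\<ge>0. has_ito_integral M F W t f (\<lambda>\<omega>. X t \<omega> - X 0 \<omega>))"

end

(*
  Put A = alpha b and B = beta b. Approximate the two Ito integrals by left-endpoint sums over a
  grid of mesh h = t/n, let S_k be the exponential of i times the partial sum, and let
  u_k = E[S_k chi(kh)], v_k = E[S_k (1 - chi(kh))]. Increments of (w, N) are independent of the
  past and of each other, and chi takes values in {0, 1}, so (u_k, v_k) is obtained from (1, 0) by
  applying k times an explicit 2x2 matrix I + hR + O(h^2), where R has rows
  (-A^2/2 - lambda, lambda) and (lambda, -B^2/2 - lambda). As n grows, (u_n, v_n) tends to
  exp(tR)(1, 0), whose entries sum to J(t); the equation for J is the Cayley-Hamilton identity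
  for R. The Ito isometry, and E(chi(s) - chi(r))^2 = O(s - r), show that the left-endpoint sums
  converge to the integrals in L^2, whatever simple processes define them.
*)

theory Submission
  imports Defs
begin

subsection \<open>Independence of increments from the past\<close>

text \<open>The filtration is generated by both processes, because the integrand is read off from N.
  That w keeps its Wiener behaviour for this larger filtration is where independence of the two
  whole processes enters, and it has to be derived from finite-dimensional events. An Ito integral
  is given only through some unknown sequence of simple processes, on partitions unrelated to the
  grid. Hence the isometry is proved for sums over arbitrarily overlapping intervals, and a
  difference of two simple processes is one such sum. The recursion closes on two numbers because
  sin N vanishes: cos N(s) = cos N(r) cos(N(s) - N(r)), so the direction after a step depends only
  on the direction before it and the parity of the jumps in between. Since chi is frozen on each
  grid cell, the recursion is exact; its matrix has nonnegative entries and column sums at most 1,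
  so one-step errors add up but are never amplified. No derivative is taken under the expectation:
  exp(tR) is written out with hyperbolic functions, and J is differentiated through this closed
  form.\<close>

lemma vimage_Pair_Times: "(\<lambda>x. (f x, g x)) -` (A \<times> B) \<inter> S = (f -` A \<inter> S) \<inter> (g -` B \<inter> S)"
  by auto

text \<open>With the times of \<open>S\<close> sorted, each value of \<open>X\<close> is a partial
  sum of increments over consecutive times, so the past event depends on one block of independent
  increments and the future event on the next increment alone.\<close>

lemma (in prob_space) indep_increments_past:
  fixes X :: "real \<Rightarrow> 'a \<Rightarrow> real"
  assumes X: "\<And>t. 0 \<le> t \<Longrightarrow> X t \<in> borel_measurable M"
    and X0: "AE \<omega> in M. X 0 \<omega> = 0"
    and inc: "indep_increments M X"
    and ab: "0 \<le> a" "a \<le> b"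
    and S: "finite S" "S \<subseteq> {0..a}"
    and A: "\<And>s. s \<in> S \<Longrightarrow> A s \<in> sets borel"
    and B: "B \<in> sets borel"
  shows "prob ({\<omega>\<in>space M. \<forall>s\<in>S. X s \<omega> \<in> A s} \<inter> {\<omega>\<in>space M. X b \<omega> - X a \<omega> \<in> B}) =
    prob {\<omega>\<in>space M. \<forall>s\<in>S. X s \<omega> \<in> A s} * prob {\<omega>\<in>space M. X b \<omega> - X a \<omega> \<in> B}"
proof -
  define xs where "xs = sorted_list_of_set (insert 0 (insert a S))"
  have set_xs: "set xs = insert 0 (insert a S)" and sorted: "sorted xs"
    using S unfolding xs_def by (auto simp del: sorted_list_of_set_insert_remove)
  have "length xs > 0" using set_xs by (cases xs) auto
  then obtain n where n: "length xs = Suc n" by (cases "length xs") auto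
  \<comment> \<open>Adjoining 0 to the times lets the sums of increments start at
    \<open>X 0\<close>; adjoining \<open>a\<close> makes increment number \<open>n\<close>, the one
    that ends at the extra point \<open>b\<close>, equal to \<open>X b - X a\<close>.\<close>
  define t where "t i = (if i \<le> n then xs ! i else b)" for i
  have mono: "xs ! i \<le> xs ! j" if "i \<le> j" "j \<le> n" for i j
    using sorted_nth_mono[OF sorted, of i j] that n by simp
  have bounds: "0 \<le> xs ! i" "xs ! i \<le> a" if "i \<le> n" for i
  proof -
    have "xs ! i \<in> insert 0 (insert a S)" using that n set_xs nth_mem[of i xs] by simp
    then show "0 \<le> xs ! i" "xs ! i \<le> a" using ab S by auto
  qed
  have ex: "\<exists>k\<le>n. xs ! k = s" if "s \<in> insert 0 (insert a S)" for s
    using that n unfolding set_xs[symmetric] in_set_conv_nth by (auto simp: less_Suc_eq_le)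
  have t0: "t 0 = 0"
  proof -
    obtain k where "k \<le> n" "xs ! k = 0" using ex[of 0] by auto
    then show ?thesis using mono[of 0 k] bounds[of 0] by (simp add: t_def)
  qed
  have tn: "t n = a"
  proof -
    obtain k where "k \<le> n" "xs ! k = a" using ex[of a] by auto
    then show ?thesis using mono[of k n] bounds[of n] by (simp add: t_def)
  qed
  have tSn: "t (Suc n) = b" by (simp add: t_def)
  have t_mono: "\<forall>i<Suc n. t i \<le> t (Suc i)"
    using mono order_trans[OF bounds(2) ab(2)] by (simp add: t_def)
  define Z where "Z i \<omega> = X (t (Suc i)) \<omega> - X (t i) \<omega>" for i \<omega>
  have "indep_vars (\<lambda>_. borel) (\<lambda>i \<omega>. X (t (Suc i)) \<omega> - X (t i) \<omega>) {..<Suc n}"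
    using inc t_mono t0 unfolding indep_increments_def by simp
  then have ind: "indep_vars (\<lambda>_. borel) Z {..<Suc n}" by (simp add: Z_def[abs_def])
  have tele: "(\<Sum>i<k. Z i \<omega>) = X (t k) \<omega> - X 0 \<omega>" for k \<omega>
    unfolding Z_def using sum_lessThan_telescope[of "\<lambda>i. X (t i) \<omega>" k] t0 by simp
  \<comment> \<open>The past and future events transported to the space of increments: their
    preimages are \<open>E'\<close> and \<open>D\<close> below.\<close>
  define G where "G = {z\<in>space (PiM {..<n} (\<lambda>_. borel :: real measure)).
      \<forall>k\<in>{k. k \<le> n \<and> t k \<in> S}. (\<Sum>i<k. z i) \<in> A (t k)}"
  define H where "H = {z\<in>space (PiM {n} (\<lambda>_. borel :: real measure)). z n \<in> B}"
  have G: "G \<in> sets (PiM {..<n} (\<lambda>_. borel :: real measure))"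
    unfolding G_def
  proof (intro sets.sets_Collect_finite_All)
    fix k assume k: "k \<in> {k. k \<le> n \<and> t k \<in> S}"
    have "(\<lambda>z. \<Sum>i<k. z i) \<in> borel_measurable (PiM {..<n} (\<lambda>_. borel :: real measure))"
      using k by (intro borel_measurable_sum measurable_component_singleton) auto
    then show "{z\<in>space (PiM {..<n} (\<lambda>_. borel :: real measure)). (\<Sum>i<k. z i) \<in> A (t k)}
        \<in> sets (PiM {..<n} (\<lambda>_. borel :: real measure))"
      using A[of "t k"] k by (auto simp: measurable_def vimage_def Int_def conj_commute)
  qed simp
  have H: "H \<in> sets (PiM {n} (\<lambda>_. borel :: real measure))"
    unfolding H_def using B measurable_sets[OF measurable_component_singleton[of n "{n}" "\<lambda>_. borel :: real measure"], of B]
    by (auto simp: vimage_def Int_def conj_commute)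
  define E where "E = {\<omega>\<in>space M. \<forall>s\<in>S. X s \<omega> \<in> A s}"
  \<comment> \<open>Increments determine \<open>X s - X 0\<close> rather than \<open>X s\<close>. As
    \<open>X 0\<close> vanishes only almost surely, \<open>E\<close> and \<open>E'\<close> agree up
    to a null set.\<close>
  define E' where "E' = {\<omega>\<in>space M. \<forall>s\<in>S. X s \<omega> - X 0 \<omega> \<in> A s}"
  define D where "D = {\<omega>\<in>space M. X b \<omega> - X a \<omega> \<in> B}"
  have [measurable]: "X 0 \<in> borel_measurable M" "X a \<in> borel_measurable M" "X b \<in> borel_measurable M"
    using X ab by auto
  have [measurable]: "X s \<in> borel_measurable M" if "s \<in> S" for s using X S that by auto
  note A[measurable] B[measurable]
  have E: "E \<in> events" unfolding E_def using S(1)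
    by (intro sets.sets_Collect_finite_All) auto
  have E': "E' \<in> events" unfolding E'_def using S(1)
    by (intro sets.sets_Collect_finite_All) auto
  have D: "D \<in> events" unfolding D_def by measurable
  have vG: "(\<lambda>\<omega>. restrict (\<lambda>i. Z i \<omega>) {..<n}) -` G \<inter> space M = E'"
  proof -
    have "(\<Sum>i<k. restrict (\<lambda>i. Z i \<omega>) {..<n} i) = X (t k) \<omega> - X 0 \<omega>" if "k \<le> n" for k \<omega>
      unfolding tele[symmetric] using that by (intro sum.cong) auto
    moreover have "\<exists>k\<le>n. t k = s" if "s \<in> S" for s using ex[of s] that by (auto simp: t_def)
    ultimately show ?thesis unfolding G_def E'_def by (auto simp: space_PiM PiE_def)
  qed
  have vH: "(\<lambda>\<omega>. restrict (\<lambda>i. Z i \<omega>) {n}) -` H \<inter> space M = D"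
    unfolding H_def D_def by (auto simp: space_PiM PiE_def Z_def tn tSn)
  have "indep_var (PiM {..<n} (\<lambda>_. borel)) (\<lambda>\<omega>. restrict (\<lambda>i. Z i \<omega>) {..<n})
      (PiM {n} (\<lambda>_. borel)) (\<lambda>\<omega>. restrict (\<lambda>i. Z i \<omega>) {n})"
    by (rule indep_var_restrict[OF ind]) auto
  from indep_varD[OF this G H] have "prob (E' \<inter> D) = prob E' * prob D"
    by (subst (asm) vimage_Pair_Times) (simp add: vG vH)
  moreover have "prob (E \<inter> D) = prob (E' \<inter> D)"
    using E E' D X0 by (intro measure_eq_AE) (auto simp: E_def E'_def D_def)
  moreover have "prob E = prob E'"
    using E E' X0 by (intro measure_eq_AE) (auto simp: E_def E'_def)
  ultimately show ?thesis unfolding E_def D_def by simp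
qed

section \<open>Finite-dimensional cylinder events\<close>

lemma sets_Collect_finite_cylinder:
  assumes "finite S" "\<And>s. s \<in> S \<Longrightarrow> f s \<in> borel_measurable K" "\<And>s. s \<in> S \<Longrightarrow> A s \<in> sets borel"
  shows "{\<omega>\<in>space K. \<forall>s\<in>S. f s \<omega> \<in> A s} \<in> sets K"
proof (rule sets.sets_Collect_finite_All[OF _ assms(1)])
  fix s assume "s \<in> S"
  from measurable_sets[OF assms(2)[OF this] assms(3)[OF this]]
  show "{\<omega>\<in>space K. f s \<omega> \<in> A s} \<in> sets K"
    by (simp add: vimage_def Int_def conj_commute)
qed

text \<open>An intersection-stable family that generates the past of one process, so that
  independence may be tested on it. The constraint \<open>A\<close> is total, and borel at every
  time, so that cylinders over different time sets combine easily.\<close>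

definition cylinders :: "'a measure \<Rightarrow> (real \<Rightarrow> 'a \<Rightarrow> real) \<Rightarrow> real \<Rightarrow> 'a set set" where
  "cylinders M X a = {{\<omega>\<in>space M. \<forall>s\<in>S. X s \<omega> \<in> A s} | S A.
     finite S \<and> S \<subseteq> {0..a} \<and> (\<forall>s. A s \<in> sets borel)}"

lemma cylindersI:
  "finite S \<Longrightarrow> S \<subseteq> {0..a} \<Longrightarrow> (\<And>s. A s \<in> sets borel) \<Longrightarrow>
    {\<omega>\<in>space M. \<forall>s\<in>S. X s \<omega> \<in> A s} \<in> cylinders M X a"
  unfolding cylinders_def by blast

lemma cylinders_Int:
  assumes "E \<in> cylinders M X a" "E' \<in> cylinders M X a"
  shows "E \<inter> E' \<in> cylinders M X a"
proof -
  obtain S A T B where E: "finite S" "S \<subseteq> {0..a}" "\<And>s. A s \<in> sets borel"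
      "E = {\<omega>\<in>space M. \<forall>s\<in>S. X s \<omega> \<in> A s}"
    and E': "finite T" "T \<subseteq> {0..a}" "\<And>s. B s \<in> sets borel"
      "E' = {\<omega>\<in>space M. \<forall>s\<in>T. X s \<omega> \<in> B s}"
    using assms unfolding cylinders_def by blast
  \<comment> \<open>At a time constrained by only one of the two cylinders, the other contributes
    the trivial constraint \<open>UNIV\<close>.\<close>
  define C where "C s = (if s \<in> S then A s else UNIV) \<inter> (if s \<in> T then B s else UNIV)" for s
  have "E \<inter> E' = {\<omega>\<in>space M. \<forall>s\<in>S \<union> T. X s \<omega> \<in> C s}"
    unfolding E(4) E'(4) C_def by auto
  also have "\<dots> \<in> cylinders M X a"
    by (rule cylindersI) (use E E' in \<open>auto simp: C_def\<close>)
  finally show ?thesis .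
qed

lemma vimage_cylinder:
  "0 \<le> s \<Longrightarrow> s \<le> a \<Longrightarrow> A \<in> sets borel \<Longrightarrow> X s -` A \<inter> space M \<in> cylinders M X a"
  using cylindersI[of "{s}" a "\<lambda>_. A" M X] by (simp add: vimage_def Int_def conj_commute)

lemma space_cylinder: "space M \<in> cylinders M X a"
  using cylindersI[of "{}" a "\<lambda>_. UNIV" M X] by simp

section \<open>The two processes and their joint filtration\<close>

locale switched_wiener = prob_space M for M :: "'a measure" +
  fixes W N :: "real \<Rightarrow> 'a \<Rightarrow> real" and lam :: real
  assumes lam_pos: "lam > 0"
    and wiener: "wiener_process M W"
    and poisson: "poisson_process M lam (\<lambda>t \<omega>. N t \<omega> / pi)"
    and indep_WN: "indep_processes M W N"
begin

lemma W_measurable: "0 \<le> t \<Longrightarrow> W t \<in> borel_measurable M"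
  using wiener by (simp add: wiener_process_def)

lemma N_measurable: "0 \<le> t \<Longrightarrow> N t \<in> borel_measurable M"
proof -
  assume "0 \<le> t"
  then have [measurable]: "(\<lambda>\<omega>. N t \<omega> / pi) \<in> borel_measurable M"
    using poisson by (simp add: poisson_process_def)
  have "(\<lambda>\<omega>. pi * (N t \<omega> / pi)) \<in> borel_measurable M" by measurable
  then show ?thesis by simp
qed

lemma W0: "AE \<omega> in M. W 0 \<omega> = 0"
  using wiener by (simp add: wiener_process_def)

lemma N0: "AE \<omega> in M. N 0 \<omega> = 0"
  using poisson by (simp add: poisson_process_def)

lemma indep_increments_W: "indep_increments M W"
  using wiener by (simp add: wiener_process_def)

lemma indep_increments_N: "indep_increments M N"
  unfolding indep_increments_def
proof (intro allI impI)
  fix n :: nat and t :: "nat \<Rightarrow> real"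
  assume "0 \<le> t 0" "\<forall>i<n. t i \<le> t (Suc i)"
  then have "indep_vars (\<lambda>_. borel) (\<lambda>i \<omega>. N (t (Suc i)) \<omega> / pi - N (t i) \<omega> / pi) {..<n}"
    using poisson unfolding poisson_process_def indep_increments_def by blast
  then have "indep_vars (\<lambda>_. borel) (\<lambda>i \<omega>. pi * (N (t (Suc i)) \<omega> / pi - N (t i) \<omega> / pi)) {..<n}"
    by (rule indep_vars_compose2) auto
  then show "indep_vars (\<lambda>_. borel) (\<lambda>i \<omega>. N (t (Suc i)) \<omega> - N (t i) \<omega>) {..<n}"
    by (simp add: right_diff_distrib)
qed

lemma cylinders_W: "cylinders M W a \<subseteq> events"
proof
  fix E assume "E \<in> cylinders M W a"
  then obtain S A where "finite S" "S \<subseteq> {0..a}" "\<And>s. A s \<in> sets borel"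
      "E = {\<omega>\<in>space M. \<forall>s\<in>S. W s \<omega> \<in> A s}"
    unfolding cylinders_def by blast
  then show "E \<in> events"
    using W_measurable by (simp add: subset_iff sets_Collect_finite_cylinder)
qed

lemma cylinders_N: "cylinders M N a \<subseteq> events"
proof
  fix E assume "E \<in> cylinders M N a"
  then obtain S A where "finite S" "S \<subseteq> {0..a}" "\<And>s. A s \<in> sets borel"
      "E = {\<omega>\<in>space M. \<forall>s\<in>S. N s \<omega> \<in> A s}"
    unfolding cylinders_def by blast
  then show "E \<in> events"
    using N_measurable by (simp add: subset_iff sets_Collect_finite_cylinder)
qed

text \<open>Independence of the processes separates the W-events from the N-events, independent
  increments split past from future within each process, and independence of the processes then
  reassembles the two pasts and the two futures.\<close>

lemma prob_past_increments:
  assumes ab: "0 \<le> a" "a \<le> b"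
    and E: "E \<in> cylinders M W a" "E' \<in> cylinders M N a"
    and B: "B \<in> sets borel" "B' \<in> sets borel"
  defines "D \<equiv> {\<omega>\<in>space M. W b \<omega> - W a \<omega> \<in> B}"
    and "D' \<equiv> {\<omega>\<in>space M. N b \<omega> - N a \<omega> \<in> B'}"
  shows "prob ((E \<inter> E') \<inter> (D \<inter> D')) = prob (E \<inter> E') * prob (D \<inter> D')"
proof -
  obtain S A T C where S: "finite S" "S \<subseteq> {0..a}" "\<And>s. A s \<in> sets borel"
      "E = {\<omega>\<in>space M. \<forall>s\<in>S. W s \<omega> \<in> A s}"
    and T: "finite T" "T \<subseteq> {0..a}" "\<And>s. C s \<in> sets borel"
      "E' = {\<omega>\<in>space M. \<forall>s\<in>T. N s \<omega> \<in> C s}"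
    using E unfolding cylinders_def by blast
  let ?P = "PiM {0..} (\<lambda>_. borel :: real measure)"
  let ?W = "\<lambda>\<omega>. \<lambda>t\<in>{0..}. W t \<omega>" and ?N = "\<lambda>\<omega>. \<lambda>t\<in>{0..}. N t \<omega>"
  define past where "past S A = {w\<in>space ?P. \<forall>s\<in>S. w s \<in> A s}" for S :: "real set" and A :: "real \<Rightarrow> real set"
  define fut where "fut B = {w\<in>space ?P. w b - w a \<in> B}" for B :: "real set"
  have comp: "(\<lambda>w. w s) \<in> borel_measurable ?P" if "0 \<le> s" for s
    using that by (intro measurable_component_singleton) auto
  have past: "past S A \<in> sets ?P" if "finite S" "S \<subseteq> {0..a}" "\<And>s. A s \<in> sets borel" for S A
    unfolding past_def using that by (intro sets_Collect_finite_cylinder comp) auto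
  have fut: "fut B \<in> sets ?P" if "B \<in> sets borel" for B
  proof -
    have "(\<lambda>w. w b - w a) \<in> borel_measurable ?P"
      using ab by (intro borel_measurable_diff comp) auto
    from measurable_sets[OF this that] show ?thesis
      unfolding fut_def by (simp add: vimage_def Int_def conj_commute)
  qed
  have vE: "?W -` past S A \<inter> space M = E" "?N -` past T C \<inter> space M = E'"
    unfolding past_def S(4) T(4) using S(2) T(2) by (auto simp: space_PiM subset_iff)
  have vD: "?W -` fut B \<inter> space M = D" "?N -` fut B' \<inter> space M = D'"
    unfolding fut_def D_def D'_def using ab by (auto simp: space_PiM)
  have split: "prob ((?W -` X \<inter> space M) \<inter> (?N -` Y \<inter> space M)) =
      prob (?W -` X \<inter> space M) * prob (?N -` Y \<inter> space M)"
    if "X \<in> sets ?P" "Y \<in> sets ?P" for X Y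
    using indep_varD[OF indep_WN[unfolded indep_processes_def] that] by (subst (asm) vimage_Pair_Times)
  have "prob ((E \<inter> E') \<inter> (D \<inter> D')) = prob ((E \<inter> D) \<inter> (E' \<inter> D'))"
    by (simp add: Int_ac)
  also have "\<dots> = prob (E \<inter> D) * prob (E' \<inter> D')"
  proof -
    have "?W -` (past S A \<inter> fut B) \<inter> space M = E \<inter> D"
      "?N -` (past T C \<inter> fut B') \<inter> space M = E' \<inter> D'"
      unfolding vE[symmetric] vD[symmetric] by blast+
    then show ?thesis
      using split[of "past S A \<inter> fut B" "past T C \<inter> fut B'"] past fut S T B
      by (simp add: sets.Int)
  qed
  also have "prob (E \<inter> D) = prob E * prob D"
    unfolding S(4) D_def
    by (rule indep_increments_past[OF W_measurable W0 indep_increments_W]) (use ab S B in auto)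
  also have "prob (E' \<inter> D') = prob E' * prob D'"
    unfolding T(4) D'_def
    by (rule indep_increments_past[OF N_measurable N0 indep_increments_N]) (use ab T B in auto)
  also have "prob E * prob D * (prob E' * prob D') = (prob E * prob E') * (prob D * prob D')"
    by simp
  also have "prob E * prob E' = prob (E \<inter> E')"
    using split[of "past S A" "past T C"] past S T by (simp add: vE)
  also have "prob D * prob D' = prob (D \<inter> D')"
    using split[of "fut B" "fut B'"] fut B by (simp add: vD)
  finally show ?thesis .
qed

abbreviation past :: "real \<Rightarrow> 'a measure" where
  "past \<equiv> natural_filtration M (\<lambda>t \<omega>. (W t \<omega>, N t \<omega>))"

lemma space_past [simp]: "space (past a) = space M"
  unfolding natural_filtration_def by (rule space_measure_of) auto

lemma sets_past: "sets (past a) =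
    sigma_sets (space M) (\<Union>s\<in>{0..a}. {(\<lambda>\<omega>. (W s \<omega>, N s \<omega>)) -` A \<inter> space M | A. A \<in> sets borel})"
  unfolding natural_filtration_def by (rule sets_measure_of) auto

text \<open>A pair is Borel measurable as soon as both coordinates are, which reduces planar Borel
  sets to rectangles. A condition on a single coordinate is of the required form because the whole
  space is a cylinder over no times.\<close>

lemma sets_past_le_cylinders:
  "sets (past a) \<subseteq> sigma_sets (space M) {E \<inter> E' | E E'. E \<in> cylinders M W a \<and> E' \<in> cylinders M N a}"
    (is "_ \<subseteq> sigma_sets _ ?C")
proof -
  let ?K = "sigma (space M) ?C"
  have "?C \<subseteq> Pow (space M)"
    using cylinders_W cylinders_N sets.sets_into_space by blast
  then have [simp]: "space ?K = space M" "sets ?K = sigma_sets (space M) ?C"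
    by (auto intro!: space_measure_of sets_measure_of)
  have CI: "E \<inter> E' \<in> sigma_sets (space M) ?C" if "E \<in> cylinders M W a" "E' \<in> cylinders M N a" for E E'
    using that by (intro sigma_sets.Basic) blast
  have "(\<lambda>\<omega>. (W s \<omega>, N s \<omega>)) -` A \<inter> space M \<in> sigma_sets (space M) ?C"
    if s: "0 \<le> s" "s \<le> a" and A: "A \<in> sets borel" for s A
  proof -
    have "W s \<in> borel_measurable ?K"
    proof (rule measurableI)
      fix B :: "real set" assume "B \<in> sets borel"
      from CI[OF vimage_cylinder[OF s this] space_cylinder]
      show "W s -` B \<inter> space ?K \<in> sets ?K" by (simp add: Int_assoc)
    qed simp
    moreover have "N s \<in> borel_measurable ?K"
    proof (rule measurableI)
      fix B :: "real set" assume "B \<in> sets borel"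
      from CI[OF space_cylinder vimage_cylinder[OF s this]]
      show "N s -` B \<inter> space ?K \<in> sets ?K" by (simp add: Int_ac)
    qed simp
    ultimately have "(\<lambda>\<omega>. (W s \<omega>, N s \<omega>)) \<in> borel_measurable ?K"
      by (rule borel_measurable_Pair)
    from measurable_sets[OF this A] show ?thesis by simp
  qed
  then show ?thesis unfolding sets_past by (intro sigma_sets_mono) auto
qed

lemma sets_past_le_events: "sets (past a) \<subseteq> events"
proof (rule order_trans[OF sets_past_le_cylinders sets.sigma_sets_subset])
  show "{E \<inter> E' | E E'. E \<in> cylinders M W a \<and> E' \<in> cylinders M N a} \<subseteq> events"
    using cylinders_W cylinders_N by blast
qed

lemma past_measurable: "Z \<in> measurable (past a) L \<Longrightarrow> Z \<in> measurable M L"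
  using sets_past_le_events[of a] unfolding measurable_def by auto

text \<open>Both sides have intersection-stable generators, past cylinders and rectangles of
  increments, on which \<open>prob_past_increments\<close> gives the product rule; it then extends
  to the generated sigma-algebras. This is the Wiener and Poisson property relative to
  \<open>past\<close>, for both increments jointly.\<close>

lemma indep_past:
  assumes ab: "0 \<le> a" "a \<le> b" and Z: "Z \<in> measurable (past a) L"
    and g: "g \<in> measurable borel L'"
  shows "indep_var L Z L' (\<lambda>\<omega>. g (W b \<omega> - W a \<omega>, N b \<omega> - N a \<omega>))"
proof -
  let ?Y = "\<lambda>\<omega>. (W b \<omega> - W a \<omega>, N b \<omega> - N a \<omega>)"
  let ?gY = "\<lambda>\<omega>. g (W b \<omega> - W a \<omega>, N b \<omega> - N a \<omega>)"
  define C where "C = {E \<inter> E' | E E'. E \<in> cylinders M W a \<and> E' \<in> cylinders M N a}"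
  define D where "D = {{\<omega>\<in>space M. W b \<omega> - W a \<omega> \<in> B} \<inter> {\<omega>\<in>space M. N b \<omega> - N a \<omega> \<in> B'} | B B'.
    B \<in> sets borel \<and> B' \<in> sets borel}"
  have [measurable]: "W a \<in> borel_measurable M" "W b \<in> borel_measurable M"
      "N a \<in> borel_measurable M" "N b \<in> borel_measurable M"
    using W_measurable N_measurable ab by auto
  have C: "C \<subseteq> events" unfolding C_def using cylinders_W cylinders_N by blast
  have D: "D \<subseteq> events" unfolding D_def by auto
  have "indep_set C D"
    unfolding indep_sets2_eq using C D prob_past_increments[OF ab] by (auto simp: C_def D_def)
  moreover have "Int_stable C"
    unfolding Int_stable_def C_def
  proof safe
    fix E E' F F' assume "E \<in> cylinders M W a" "E' \<in> cylinders M N a"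
      "F \<in> cylinders M W a" "F' \<in> cylinders M N a"
    then show "\<exists>G G'. E \<inter> E' \<inter> (F \<inter> F') = G \<inter> G' \<and> G \<in> cylinders M W a \<and> G' \<in> cylinders M N a"
      by (intro exI[of _ "E \<inter> F"] exI[of _ "E' \<inter> F'"]) (auto simp: cylinders_Int)
  qed
  moreover have "Int_stable D"
    unfolding Int_stable_def D_def
  proof safe
    fix B B' C C' :: "real set"
    assume *: "B \<in> sets borel" "B' \<in> sets borel" "C \<in> sets borel" "C' \<in> sets borel"
    show "\<exists>G G'. {\<omega> \<in> space M. W b \<omega> - W a \<omega> \<in> B} \<inter> {\<omega> \<in> space M. N b \<omega> - N a \<omega> \<in> B'} \<inter>
        ({\<omega> \<in> space M. W b \<omega> - W a \<omega> \<in> C} \<inter> {\<omega> \<in> space M. N b \<omega> - N a \<omega> \<in> C'}) =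
        {\<omega> \<in> space M. W b \<omega> - W a \<omega> \<in> G} \<inter> {\<omega> \<in> space M. N b \<omega> - N a \<omega> \<in> G'} \<and>
        G \<in> sets borel \<and> G' \<in> sets borel"
      by (intro exI[of _ "B \<inter> C"] exI[of _ "B' \<inter> C'"]) (use * in auto)
  qed
  ultimately have ind: "indep_set (sigma_sets (space M) C) (sigma_sets (space M) D)"
    by (rule indep_set_sigma_sets)
  have past_C: "sets (past a) \<subseteq> sigma_sets (space M) C"
    unfolding C_def by (rule sets_past_le_cylinders)
  have ZC: "Z -` A \<inter> space M \<in> sigma_sets (space M) C" if "A \<in> sets L" for A
    using measurable_sets[OF Z that] past_C by auto
  have ZM: "random_variable L Z" using Z by (rule past_measurable)
  have "random_variable borel ?Y"
    by (intro borel_measurable_Pair) measurable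
  then have YM: "random_variable L' ?gY" using g by (rule measurable_compose)
  let ?K = "sigma (space M) D"
  have "D \<subseteq> Pow (space M)"
    using D sets.sets_into_space by blast
  then have [simp]: "space ?K = space M" "sets ?K = sigma_sets (space M) D"
    by (auto intro!: space_measure_of sets_measure_of)
  have DI: "{\<omega>\<in>space M. W b \<omega> - W a \<omega> \<in> B} \<inter> {\<omega>\<in>space M. N b \<omega> - N a \<omega> \<in> B'} \<in> sigma_sets (space M) D"
    if "B \<in> sets borel" "B' \<in> sets borel" for B B'
    unfolding D_def using that by (intro sigma_sets.Basic CollectI exI[of _ B] exI[of _ B'] conjI refl)
  have "(\<lambda>\<omega>. W b \<omega> - W a \<omega>) \<in> borel_measurable ?K"
  proof (rule measurableI)
    fix B :: "real set" assume "B \<in> sets borel"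
    from DI[OF this, of UNIV] show "(\<lambda>\<omega>. W b \<omega> - W a \<omega>) -` B \<inter> space ?K \<in> sets ?K"
      by (simp add: vimage_def Int_def conj_ac)
  qed simp
  moreover have "(\<lambda>\<omega>. N b \<omega> - N a \<omega>) \<in> borel_measurable ?K"
  proof (rule measurableI)
    fix B :: "real set" assume "B \<in> sets borel"
    from DI[OF _ this, of UNIV] show "(\<lambda>\<omega>. N b \<omega> - N a \<omega>) -` B \<inter> space ?K \<in> sets ?K"
      by (simp add: vimage_def Int_def conj_ac)
  qed simp
  ultimately have "?Y \<in> borel_measurable ?K" by (rule borel_measurable_Pair)
  then have "?gY \<in> measurable ?K L'" using g by (rule measurable_compose)
  then have YD: "?gY -` A \<inter> space M \<in> sigma_sets (space M) D" if "A \<in> sets L'" for A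
    using measurable_sets[OF _ that, of ?gY ?K] by simp
  \<comment> \<open>Independence is inherited by the smaller sigma-algebras generated by the two
    random variables.\<close>
  have "indep_set (sigma_sets (space M) {Z -` A \<inter> space M | A. A \<in> sets L})
      (sigma_sets (space M) {?gY -` A \<inter> space M | A. A \<in> sets L'})"
    unfolding indep_sets2_eq
  proof (intro conjI ballI)
    have 1: "sigma_sets (space M) {Z -` A \<inter> space M | A. A \<in> sets L} \<subseteq> sigma_sets (space M) C"
      by (rule sigma_sets_mono) (use ZC in auto)
    have 2: "sigma_sets (space M) {?gY -` A \<inter> space M | A. A \<in> sets L'} \<subseteq> sigma_sets (space M) D"
      by (rule sigma_sets_mono) (use YD in auto)
    show "sigma_sets (space M) {Z -` A \<inter> space M | A. A \<in> sets L} \<subseteq> events"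
      using 1 indep_setD_ev1[OF ind] by (rule subset_trans)
    show "sigma_sets (space M) {?gY -` A \<inter> space M | A. A \<in> sets L'} \<subseteq> events"
      using 2 indep_setD_ev2[OF ind] by (rule subset_trans)
    show "prob (x \<inter> y) = prob x * prob y"
      if "x \<in> sigma_sets (space M) {Z -` A \<inter> space M | A. A \<in> sets L}"
         "y \<in> sigma_sets (space M) {?gY -` A \<inter> space M | A. A \<in> sets L'}" for x y
      using 1 2 that indep_setD[OF ind] by blast
  qed
  then show ?thesis unfolding indep_var_eq using ZM YM by blast
qed

lemma W_past: "0 \<le> s \<Longrightarrow> s \<le> a \<Longrightarrow> W s \<in> borel_measurable (past a)"
  and N_past: "0 \<le> s \<Longrightarrow> s \<le> a \<Longrightarrow> N s \<in> borel_measurable (past a)"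
proof -
  assume s: "0 \<le> s" "s \<le> a"
  have WN: "(\<lambda>\<omega>. (W s \<omega>, N s \<omega>)) \<in> borel_measurable (past a)"
  proof (rule measurableI)
    fix A :: "(real \<times> real) set" assume "A \<in> sets borel"
    then show "(\<lambda>\<omega>. (W s \<omega>, N s \<omega>)) -` A \<inter> space (past a) \<in> sets (past a)"
      unfolding sets_past space_past using s by (intro sigma_sets.Basic UN_I[of s]) auto
  qed simp
  have "(\<lambda>\<omega>. fst (W s \<omega>, N s \<omega>)) \<in> borel_measurable (past a)"
    using WN by (rule measurable_compose[OF _ borel_measurable_continuous_onI]) (intro continuous_intros)
  then show "W s \<in> borel_measurable (past a)" by simp
  have "(\<lambda>\<omega>. snd (W s \<omega>, N s \<omega>)) \<in> borel_measurable (past a)"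
    using WN by (rule measurable_compose[OF _ borel_measurable_continuous_onI]) (intro continuous_intros)
  then show "N s \<in> borel_measurable (past a)" by simp
qed

lemma past_mono: "a \<le> b \<Longrightarrow> sets (past a) \<subseteq> sets (past b)"
  unfolding sets_past by (intro sigma_sets_subseteq UN_mono) auto

lemma past_measurable_mono:
  "a \<le> b \<Longrightarrow> Z \<in> measurable (past a) L \<Longrightarrow> Z \<in> measurable (past b) L"
  using past_mono[of a b] unfolding measurable_def by auto

end

subsection \<open>Moments and characteristic functions of increments\<close>

text \<open>Since cos(pi k) = (-1)^k, the sum is exp(-r) times the exponential series at -r. The
  value is the probability of an even count minus that of an odd one.\<close>

lemma poisson_expectation_cos:
  assumes "0 < r"
  shows "(\<integral>k. cos (pi * real k) \<partial>measure_pmf (poisson_pmf r)) = exp (- (2 * r))"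
proof -
  have sums: "(\<lambda>k. pmf (poisson_pmf r) k *\<^sub>R cos (pi * real k)) sums (exp (- r) * exp (- r))"
  proof -
    have "(\<lambda>k. exp (- r) * ((- r) ^ k /\<^sub>R fact k)) sums (exp (- r) * exp (- r))"
      by (intro sums_mult exp_converges)
    moreover have "exp (- r) * ((- r) ^ k /\<^sub>R fact k) = pmf (poisson_pmf r) k *\<^sub>R cos (pi * real k)" for k
    proof -
      have "(- r) ^ k = (- 1) ^ k * r ^ k" by (simp flip: power_mult_distrib)
      then show ?thesis using assms by (simp add: field_simps cos_npi2)
    qed
    ultimately show ?thesis by simp
  qed
  have "integrable (measure_pmf (poisson_pmf r)) (\<lambda>k. cos (pi * real k))"
    by (intro measure_pmf.integrable_const_bound[where B=1]) auto
  then have "integrable (count_space UNIV) (\<lambda>k. pmf (poisson_pmf r) k *\<^sub>R cos (pi * real k))"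
    by (subst (asm) measure_pmf_eq_density, subst (asm) integrable_density) auto
  from sums_integral_count_space_nat[OF this] sums
  have "(\<integral>k. pmf (poisson_pmf r) k *\<^sub>R cos (pi * real k) \<partial>count_space UNIV) = exp (- r) * exp (- r)"
    using sums_unique2 by blast
  moreover have "(\<integral>k. cos (pi * real k) \<partial>measure_pmf (poisson_pmf r)) =
      (\<integral>k. pmf (poisson_pmf r) k *\<^sub>R cos (pi * real k) \<partial>count_space UNIV)"
    by (subst measure_pmf_eq_density, subst integral_density) auto
  ultimately show ?thesis by (simp flip: exp_add)
qed

context switched_wiener
begin

lemma W_increment_distributed:
  "0 \<le> a \<Longrightarrow> a < b \<Longrightarrow>
    distributed M lborel (\<lambda>\<omega>. W b \<omega> - W a \<omega>) (normal_density 0 (sqrt (b - a)))"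
  using wiener by (simp add: wiener_process_def)

lemma W_increment_integrable_square:
  assumes "0 \<le> a" "a \<le> b"
  shows "integrable M (\<lambda>\<omega>. (W b \<omega> - W a \<omega>)\<^sup>2)"
\<comment> \<open>The Gaussian law in \<open>wiener_process\<close> is stated for
  \<open>s < t\<close>. Here and below the degenerate interval is treated apart; its increment is
  identically 0.\<close>
proof (cases "a = b")
  case False
  then have ab: "a < b" using assms by simp
  have "integrable lborel (\<lambda>x. normal_density 0 (sqrt (b - a)) x * x\<^sup>2)"
    using integrable_normal_moment[of "sqrt (b - a)" 0 2] ab by simp
  then show ?thesis
    using distributed_integrable[OF W_increment_distributed[OF assms(1) ab], of "\<lambda>x. x\<^sup>2"] by simp
qed simp

lemma W_increment_integrable:
  assumes "0 \<le> a" "a \<le> b"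
  shows "integrable M (\<lambda>\<omega>. W b \<omega> - W a \<omega>)"
proof (rule square_integrable_imp_integrable[OF _ W_increment_integrable_square[OF assms]])
  show "(\<lambda>\<omega>. W b \<omega> - W a \<omega>) \<in> borel_measurable M"
    using assms by (intro borel_measurable_diff W_measurable) auto
qed

lemma W_increment_expectation:
  assumes "0 \<le> a" "a \<le> b"
  shows "expectation (\<lambda>\<omega>. W b \<omega> - W a \<omega>) = 0"
proof (cases "a = b")
  case False
  then show ?thesis
    using assms by (intro normal_distributed_expectation[OF _ W_increment_distributed]) auto
qed simp

lemma W_increment_expectation_square:
  assumes "0 \<le> a" "a \<le> b"
  shows "expectation (\<lambda>\<omega>. (W b \<omega> - W a \<omega>)\<^sup>2) = b - a"
proof (cases "a = b")
  case False
  then have ab: "a < b" using assms by simp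
  have "variance (\<lambda>\<omega>. W b \<omega> - W a \<omega>) = (sqrt (b - a))\<^sup>2"
    using ab assms by (intro normal_distributed_variance[OF _ W_increment_distributed]) auto
  then show ?thesis using W_increment_expectation[OF assms] ab by simp
qed simp

text \<open>Dividing by the standard deviation reduces this to the characteristic function of the
  standard normal law.\<close>

lemma W_increment_char:
  assumes "0 \<le> a" "a \<le> b"
  shows "(\<integral>\<omega>. exp (\<i> * complex_of_real (c * (W b \<omega> - W a \<omega>))) \<partial>M) =
    complex_of_real (exp (- (c\<^sup>2 * (b - a) / 2)))"
proof (cases "a = b")
  case True
  then show ?thesis by (simp add: prob_space)
next
  case False
  then have ab: "a < b" using assms by simp
  define s where "s = sqrt (b - a)"
  have s: "s > 0" "s\<^sup>2 = b - a" using ab by (simp_all add: s_def)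
  define X where "X = (\<lambda>\<omega>. (W b \<omega> - W a \<omega>) / s)"
  have "distributed M lborel X std_normal_density"
    using normal_standard_normal_convert[of s "\<lambda>\<omega>. W b \<omega> - W a \<omega>" 0] s
      W_increment_distributed[OF assms(1) ab] by (simp add: X_def s_def)
  then have X: "distr M lborel X = std_normal_distribution" and [measurable]: "X \<in> borel_measurable M"
    by (auto simp: distributed_def)
  have "(\<integral>\<omega>. exp (\<i> * complex_of_real (c * (W b \<omega> - W a \<omega>))) \<partial>M) =
      (\<integral>\<omega>. iexp ((c * s) * X \<omega>) \<partial>M)"
    using s by (simp add: X_def)
  also have "\<dots> = (\<integral>x. iexp ((c * s) * x) \<partial>distr M lborel X)"
    by (subst integral_distr) auto
  also have "\<dots> = char std_normal_distribution (c * s)"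
    unfolding char_def X ..
  also have "\<dots> = complex_of_real (exp (- (c\<^sup>2 * (b - a) / 2)))"
    by (simp add: char_std_normal_distribution power_mult_distrib s)
  finally show ?thesis .
qed

lemma N_increment_expectation_cos:
  assumes "0 \<le> a" "a \<le> b"
  shows "expectation (\<lambda>\<omega>. cos (N b \<omega> - N a \<omega>)) = exp (- (2 * lam * (b - a)))"
proof (cases "a = b")
  case True
  then show ?thesis by (simp add: prob_space)
next
  case False
  then have ab: "a < b" using assms by simp
  have [measurable]: "N a \<in> borel_measurable M" "N b \<in> borel_measurable M"
    using N_measurable assms by auto
  have D: "distr M borel (\<lambda>\<omega>. N b \<omega> / pi - N a \<omega> / pi) =
      distr (measure_pmf (poisson_pmf (lam * (b - a)))) borel real"
    using poisson ab assms unfolding poisson_process_def by blast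
  have "expectation (\<lambda>\<omega>. cos (N b \<omega> - N a \<omega>)) =
      (\<integral>x. cos (pi * x) \<partial>distr M borel (\<lambda>\<omega>. N b \<omega> / pi - N a \<omega> / pi))"
    by (subst integral_distr) (auto simp: right_diff_distrib)
  also have "\<dots> = (\<integral>k. cos (pi * real k) \<partial>measure_pmf (poisson_pmf (lam * (b - a))))"
    unfolding D by (subst integral_distr) auto
  also have "\<dots> = exp (- (2 * (lam * (b - a))))"
    using lam_pos ab by (intro poisson_expectation_cos) simp
  finally show ?thesis by (simp add: mult.assoc)
qed

lemma indep_W_N_increments:
  assumes ab: "0 \<le> a" "a \<le> b"
    and f: "f \<in> measurable borel L" and g: "g \<in> measurable borel L'"
  shows "indep_var L (\<lambda>\<omega>. f (W b \<omega> - W a \<omega>)) L' (\<lambda>\<omega>. g (N b \<omega> - N a \<omega>))"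
proof -
  let ?P = "PiM {0..} (\<lambda>_. borel :: real measure)"
  have d: "(\<lambda>w. w b - w a) \<in> borel_measurable ?P"
    using ab by (intro borel_measurable_diff measurable_component_singleton) auto
  from indep_var_compose[OF indep_WN[unfolded indep_processes_def]
      measurable_compose[OF d f] measurable_compose[OF d g]]
  show ?thesis using ab by (simp add: comp_def)
qed

lemma expectation_past_times:
  fixes Z :: "'a \<Rightarrow> 'b::{real_normed_field, banach, second_countable_topology}"
  assumes ab: "0 \<le> a" "a \<le> b"
    and Z: "Z \<in> borel_measurable (past a)" "integrable M Z"
    and g: "g \<in> borel_measurable borel"
    and int: "integrable M (\<lambda>\<omega>. g (W b \<omega> - W a \<omega>, N b \<omega> - N a \<omega>))"
  shows "integrable M (\<lambda>\<omega>. Z \<omega> * g (W b \<omega> - W a \<omega>, N b \<omega> - N a \<omega>))"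
    and "(\<integral>\<omega>. Z \<omega> * g (W b \<omega> - W a \<omega>, N b \<omega> - N a \<omega>) \<partial>M) =
      (\<integral>\<omega>. Z \<omega> \<partial>M) * (\<integral>\<omega>. g (W b \<omega> - W a \<omega>, N b \<omega> - N a \<omega>) \<partial>M)"
  using indep_var_integrable[OF indep_past[OF ab Z(1) g] Z(2) int]
    indep_var_lebesgue_integral[OF indep_past[OF ab Z(1) g] Z(2) int] .

text \<open>The martingale property of \<open>W\<close> and the variance of its increments, tested
  against the past. The cross terms and the diagonal terms of the Ito isometry come from
  these.\<close>

lemma past_times_W_increment:
  fixes Z :: "'a \<Rightarrow> real"
  assumes ab: "0 \<le> a" "a \<le> b"
    and Z: "Z \<in> borel_measurable (past a)" "integrable M Z"
  shows "integrable M (\<lambda>\<omega>. Z \<omega> * (W b \<omega> - W a \<omega>))"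
    and "expectation (\<lambda>\<omega>. Z \<omega> * (W b \<omega> - W a \<omega>)) = 0"
    and "integrable M (\<lambda>\<omega>. Z \<omega> * (W b \<omega> - W a \<omega>)\<^sup>2)"
    and "expectation (\<lambda>\<omega>. Z \<omega> * (W b \<omega> - W a \<omega>)\<^sup>2) = expectation Z * (b - a)"
proof -
  have f: "fst \<in> borel_measurable (borel :: (real \<times> real) measure)"
    by (intro borel_measurable_continuous_onI continuous_intros)
  then have g: "(\<lambda>p. (fst p)\<^sup>2) \<in> borel_measurable (borel :: (real \<times> real) measure)"
    by measurable
  show "integrable M (\<lambda>\<omega>. Z \<omega> * (W b \<omega> - W a \<omega>))"
    "expectation (\<lambda>\<omega>. Z \<omega> * (W b \<omega> - W a \<omega>)) = 0"
    using expectation_past_times[OF ab Z f] W_increment_integrable[OF ab] W_increment_expectation[OF ab]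
    by simp_all
  show "integrable M (\<lambda>\<omega>. Z \<omega> * (W b \<omega> - W a \<omega>)\<^sup>2)"
    "expectation (\<lambda>\<omega>. Z \<omega> * (W b \<omega> - W a \<omega>)\<^sup>2) = expectation Z * (b - a)"
    using expectation_past_times[OF ab Z g] W_increment_integrable_square[OF ab]
      W_increment_expectation_square[OF ab]
    by simp_all
qed

text \<open>One step of the recursion in a fixed direction. Since N moves by multiples of pi, the
  second factor almost surely indicates an even number of jumps for \<open>d = 1\<close> and an odd
  number for \<open>d = - 1\<close>; \<open>c\<close> is the coefficient of the active direction.
  The two increments are independent of the past and of each other, so the expectation is a product
  of three.\<close>

lemma past_times_phase:
  fixes Z :: "'a \<Rightarrow> complex" and c d :: real
  assumes ab: "0 \<le> a" "a \<le> b"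
    and Z: "Z \<in> borel_measurable (past a)" "integrable M Z"
  shows "integrable M (\<lambda>\<omega>. Z \<omega> * (exp (\<i> * complex_of_real (c * (W b \<omega> - W a \<omega>))) *
        complex_of_real ((1 + d * cos (N b \<omega> - N a \<omega>)) / 2)))" (is ?int)
    and "(\<integral>\<omega>. Z \<omega> * (exp (\<i> * complex_of_real (c * (W b \<omega> - W a \<omega>))) *
        complex_of_real ((1 + d * cos (N b \<omega> - N a \<omega>)) / 2)) \<partial>M) =
      (\<integral>\<omega>. Z \<omega> \<partial>M) * complex_of_real (exp (- (c\<^sup>2 * (b - a) / 2)) *
        ((1 + d * exp (- (2 * lam * (b - a)))) / 2))" (is ?eq)
proof -
  define f where "f x = exp (\<i> * complex_of_real (c * x))" for x :: real
  define g where "g x = complex_of_real ((1 + d * cos x) / 2)" for x :: real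
  have [measurable]: "f \<in> borel_measurable borel" "g \<in> borel_measurable borel"
    unfolding f_def g_def by (auto intro!: borel_measurable_continuous_onI continuous_intros)
  have [measurable]: "W a \<in> borel_measurable M" "W b \<in> borel_measurable M"
      "N a \<in> borel_measurable M" "N b \<in> borel_measurable M"
    using W_measurable N_measurable ab by auto
  have f_int: "integrable M (\<lambda>\<omega>. f (W b \<omega> - W a \<omega>))"
    by (intro integrable_const_bound[where B=1]) (auto simp: f_def)
  have "\<bar>(1 + d * cos x) / 2\<bar> \<le> 1 + \<bar>d\<bar>" for x
    using mult_mono[of "\<bar>d\<bar>" "\<bar>d\<bar>" "\<bar>cos x\<bar>" 1] by (simp add: abs_mult[symmetric])
  then have g_int: "integrable M (\<lambda>\<omega>. g (N b \<omega> - N a \<omega>))"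
    by (intro integrable_const_bound[where B="1 + \<bar>d\<bar>"] AE_I2) (simp_all only: g_def norm_of_real, measurable)
  note ind = indep_W_N_increments[OF ab, of f borel g borel]
  have fg_int: "integrable M (\<lambda>\<omega>. f (W b \<omega> - W a \<omega>) * g (N b \<omega> - N a \<omega>))"
    using indep_var_integrable[OF ind f_int g_int] by simp
  have "(\<integral>\<omega>. g (N b \<omega> - N a \<omega>) \<partial>M) =
      complex_of_real (expectation (\<lambda>\<omega>. (1 + d * cos (N b \<omega> - N a \<omega>)) / 2))"
    unfolding g_def by (rule integral_complex_of_real)
  also have "expectation (\<lambda>\<omega>. (1 + d * cos (N b \<omega> - N a \<omega>)) / 2) =
      (1 + d * exp (- (2 * lam * (b - a)))) / 2"
  proof -
    have "integrable M (\<lambda>\<omega>. cos (N b \<omega> - N a \<omega>))"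
      by (intro integrable_const_bound[where B=1]) auto
    then show ?thesis
      by (simp add: N_increment_expectation_cos[OF ab] prob_space)
  qed
  finally have "(\<integral>\<omega>. f (W b \<omega> - W a \<omega>) * g (N b \<omega> - N a \<omega>) \<partial>M) =
      complex_of_real (exp (- (c\<^sup>2 * (b - a) / 2)) * ((1 + d * exp (- (2 * lam * (b - a)))) / 2))"
    using indep_var_lebesgue_integral[OF ind f_int g_int] W_increment_char[OF ab, of c]
    by (simp add: f_def)
  moreover have "(\<lambda>p. f (fst p) * g (snd p)) \<in> borel_measurable (borel :: (real \<times> real) measure)"
    unfolding borel_prod[symmetric] by measurable
  ultimately show ?int ?eq
    using expectation_past_times[OF ab Z, of "\<lambda>p. f (fst p) * g (snd p)"] fg_int
    by (simp_all add: f_def g_def)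
qed

text \<open>The pathwise form of the quantisation of N. It yields that cos N squares to 1 and is
  multiplicative over increments.\<close>

lemma sin_N: "AE \<omega> in M. \<forall>t\<ge>0. sin (N t \<omega>) = 0"
proof -
  have "AE \<omega> in M. \<forall>t\<ge>0. N t \<omega> / pi \<in> \<nat>"
    using poisson by (auto simp: poisson_process_def elim: eventually_mono)
  then show ?thesis
  proof eventually_elim
    case (elim \<omega>)
    show ?case
    proof (intro allI impI)
      fix t :: real assume "0 \<le> t"
      then obtain k where "N t \<omega> / pi = real k" using elim by (auto simp: Nats_def)
      then have "N t \<omega> = real k * pi" by (simp add: field_simps)
      then show "sin (N t \<omega>) = 0" by simp
    qed
  qed
qed

end

subsection \<open>The Ito isometry\<close>

lemma integrable_times_square_integrable:
  fixes f g :: "'a \<Rightarrow> real"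
  assumes [measurable]: "f \<in> borel_measurable M" "g \<in> borel_measurable M"
    and sq: "integrable M (\<lambda>x. (f x)\<^sup>2)" "integrable M (\<lambda>x. (g x)\<^sup>2)"
  shows "integrable M (\<lambda>x. f x * g x)"
proof (rule Bochner_Integration.integrable_bound[OF Bochner_Integration.integrable_add[OF sq]])
  show "AE x in M. norm (f x * g x) \<le> norm ((f x)\<^sup>2 + (g x)\<^sup>2)"
  proof (rule AE_I2)
    fix x
    have "2 * \<bar>f x\<bar> * \<bar>g x\<bar> \<le> (f x)\<^sup>2 + (g x)\<^sup>2"
      using sum_squares_bound[of "\<bar>f x\<bar>" "\<bar>g x\<bar>"] by simp
    moreover have "0 \<le> \<bar>f x\<bar> * \<bar>g x\<bar>" by simp
    ultimately show "norm (f x * g x) \<le> norm ((f x)\<^sup>2 + (g x)\<^sup>2)"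
      unfolding real_norm_def abs_mult by linarith
  qed
qed measurable

context switched_wiener
begin

definition bounded_past :: "real \<Rightarrow> ('a \<Rightarrow> real) \<Rightarrow> bool" where
  "bounded_past a Z \<longleftrightarrow> Z \<in> borel_measurable (past a) \<and> (\<exists>C. \<forall>\<omega>\<in>space M. \<bar>Z \<omega>\<bar> \<le> C)"

lemma bounded_past_mono: "bounded_past a Z \<Longrightarrow> a \<le> b \<Longrightarrow> bounded_past b Z"
  unfolding bounded_past_def using past_measurable_mono by blast

lemma bounded_past_mult:
  assumes "bounded_past a Y" "bounded_past a Z"
  shows "bounded_past a (\<lambda>\<omega>. Y \<omega> * Z \<omega>)"
proof -
  obtain C D where C: "\<forall>\<omega>\<in>space M. \<bar>Y \<omega>\<bar> \<le> C" and D: "\<forall>\<omega>\<in>space M. \<bar>Z \<omega>\<bar> \<le> D"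
    using assms unfolding bounded_past_def by blast
  have "\<bar>Y \<omega> * Z \<omega>\<bar> \<le> C * D" if "\<omega> \<in> space M" for \<omega>
    unfolding abs_mult using C D that by (intro mult_mono) (auto intro: order_trans[OF abs_ge_zero])
  then show ?thesis
    using assms unfolding bounded_past_def by (auto intro: borel_measurable_times)
qed

lemma bounded_past_uminus: "bounded_past a Z \<Longrightarrow> bounded_past a (\<lambda>\<omega>. - Z \<omega>)"
  unfolding bounded_past_def by auto

lemma bounded_past_measurable: "bounded_past a Z \<Longrightarrow> Z \<in> borel_measurable M"
  unfolding bounded_past_def by (blast intro: past_measurable)

lemma bounded_past_integrable: "bounded_past a Z \<Longrightarrow> integrable M Z"
proof -
  assume Z: "bounded_past a Z"
  then obtain C where "\<forall>\<omega>\<in>space M. \<bar>Z \<omega>\<bar> \<le> C" unfolding bounded_past_def by blast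
  then show "integrable M Z"
    by (intro integrable_const_bound[where B=C] AE_I2 bounded_past_measurable[OF Z]) simp
qed

lemma bounded_past_times_increment_square:
  assumes "bounded_past a Z" "0 \<le> a" "a \<le> b"
  shows "integrable M (\<lambda>\<omega>. Z \<omega> * (W b \<omega> - W a \<omega>)\<^sup>2)"
    and "expectation (\<lambda>\<omega>. Z \<omega> * (W b \<omega> - W a \<omega>)\<^sup>2) = expectation Z * (b - a)"
  using past_times_W_increment(3,4)[OF assms(2,3)] bounded_past_integrable[OF assms(1)] assms(1)
  by (auto simp: bounded_past_def)

lemma square_integrable_increment:
  assumes "bounded_past a Z" "0 \<le> c" "c \<le> b"
  shows "integrable M (\<lambda>\<omega>. (Z \<omega> * (W b \<omega> - W c \<omega>))\<^sup>2)"
proof -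
  obtain C where C: "\<forall>\<omega>\<in>space M. \<bar>Z \<omega>\<bar> \<le> C"
    using assms(1) unfolding bounded_past_def by blast
  have [measurable]: "Z \<in> borel_measurable M" "W b \<in> borel_measurable M" "W c \<in> borel_measurable M"
    using bounded_past_measurable[OF assms(1)] W_measurable assms by auto
  show ?thesis
  proof (rule Bochner_Integration.integrable_bound[OF integrable_mult_right[OF W_increment_integrable_square[OF assms(2,3)], of "C\<^sup>2"]])
    show "AE \<omega> in M. norm ((Z \<omega> * (W b \<omega> - W c \<omega>))\<^sup>2) \<le> norm (C\<^sup>2 * (W b \<omega> - W c \<omega>)\<^sup>2)"
    proof (rule AE_I2)
      fix \<omega> assume "\<omega> \<in> space M"
      then have "(Z \<omega>)\<^sup>2 \<le> C\<^sup>2" using C by (metis power2_abs power_mono abs_ge_zero)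
      then show "norm ((Z \<omega> * (W b \<omega> - W c \<omega>))\<^sup>2) \<le> norm (C\<^sup>2 * (W b \<omega> - W c \<omega>)\<^sup>2)"
        by (simp add: power_mult_distrib mult_right_mono)
    qed
  qed measurable
qed

lemma integrable_increment_products:
  assumes "bounded_past e Z" "0 \<le> a" "a \<le> b" "0 \<le> c" "c \<le> d"
  shows "integrable M (\<lambda>\<omega>. Z \<omega> * (W b \<omega> - W a \<omega>) * (W d \<omega> - W c \<omega>))"
proof (rule integrable_times_square_integrable[OF _ _ square_integrable_increment W_increment_integrable_square])
  show "(\<lambda>\<omega>. Z \<omega> * (W b \<omega> - W a \<omega>)) \<in> borel_measurable M" "(\<lambda>\<omega>. W d \<omega> - W c \<omega>) \<in> borel_measurable M"
    using bounded_past_measurable[OF assms(1)] W_measurable assms by auto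
qed (use assms in auto)

text \<open>\<open>Z\<close> times the earlier increment is known at time \<open>c\<close>, and the
  later increment has mean zero against it. That product is unbounded, so its integrability is
  obtained from square integrability.\<close>

lemma expectation_disjoint_increments:
  assumes Z: "bounded_past c Z" and ord: "0 \<le> a" "a \<le> b" "b \<le> c" "c \<le> d"
  shows "expectation (\<lambda>\<omega>. Z \<omega> * (W b \<omega> - W a \<omega>) * (W d \<omega> - W c \<omega>)) = 0"
proof (rule past_times_W_increment(2))
  show "(\<lambda>\<omega>. Z \<omega> * (W b \<omega> - W a \<omega>)) \<in> borel_measurable (past c)"
    using Z W_past[of a c] W_past[of b c] ord unfolding bounded_past_def by auto
  show "integrable M (\<lambda>\<omega>. Z \<omega> * (W b \<omega> - W a \<omega>))"
  proof (rule square_integrable_imp_integrable[OF _ square_integrable_increment[OF Z]])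
    show "(\<lambda>\<omega>. Z \<omega> * (W b \<omega> - W a \<omega>)) \<in> borel_measurable M"
      using bounded_past_measurable[OF Z] W_measurable ord by auto
  qed (use ord in auto)
qed (use ord in auto)

text \<open>The maximum is the length of the overlap of the two intervals. Both are cut at the ends
  of the overlap; products of increments over disjoint pieces average to 0, and the overlap
  contributes its variance.\<close>

lemma expectation_increments_ordered:
  assumes Z: "bounded_past c Z" and ord: "0 \<le> a" "a \<le> b" "a \<le> c" "c \<le> d"
  shows "expectation (\<lambda>\<omega>. Z \<omega> * (W b \<omega> - W a \<omega>) * (W d \<omega> - W c \<omega>)) =
    expectation Z * max 0 (min b d - max a c)"
proof (cases "b \<le> c")
  case True
  then show ?thesis using expectation_disjoint_increments[OF Z] ord by (simp add: max_def min_def)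
next
  case False
  define m where "m = min b d"
  have m: "c \<le> m" "m \<le> b" "m \<le> d" and mbd: "m = b \<or> m = d" using False ord by (auto simp: m_def)
  have Zm: "bounded_past m Z" using bounded_past_mono[OF Z m(1)] .
  let ?f = "\<lambda>a b c d \<omega>. Z \<omega> * (W b \<omega> - W a \<omega>) * (W d \<omega> - W c \<omega>)"
  have int: "integrable M (?f p q r s)" if "0 \<le> p" "p \<le> q" "0 \<le> r" "r \<le> s" for p q r s
    using integrable_increment_products[OF Z that] .
  \<comment> \<open>One of the two intervals ends at \<open>m\<close>, so the product of the pieces beyond \<open>m\<close> vanishes.\<close>
  have split: "?f a b c d \<omega> = ?f a c c d \<omega> + (?f c m c m \<omega> + (?f c m m d \<omega> + ?f c m m b \<omega>))" for \<omega>
    using mbd by (auto simp: algebra_simps)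
  have "expectation (?f a b c d) = expectation (?f a c c d) +
      (expectation (?f c m c m) + (expectation (?f c m m d) + expectation (?f c m m b)))"
    unfolding split using int ord m by simp
  moreover have "expectation (?f a c c d) = 0"
    using expectation_disjoint_increments[OF Z] ord by simp
  moreover have "expectation (?f c m m d) = 0" "expectation (?f c m m b) = 0"
    using expectation_disjoint_increments[OF Zm] ord m by simp_all
  moreover have "expectation (?f c m c m) = expectation Z * (m - c)"
    using bounded_past_times_increment_square(2)[OF Z] ord m by (simp add: power2_eq_square mult.assoc)
  ultimately show ?thesis using ord m by (simp add: m_def max_def)
qed

text \<open>\<open>Y\<close> and \<open>Z\<close> are both known at the later of the two left
  endpoints, so exchanging the factors if necessary leads to the ordered case.\<close>

lemma expectation_increment_products:
  assumes Y: "bounded_past a Y" and Z: "bounded_past c Z" and ord: "0 \<le> a" "a \<le> b" "0 \<le> c" "c \<le> d"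
  shows "integrable M (\<lambda>\<omega>. (Y \<omega> * (W b \<omega> - W a \<omega>)) * (Z \<omega> * (W d \<omega> - W c \<omega>)))"
    and "expectation (\<lambda>\<omega>. (Y \<omega> * (W b \<omega> - W a \<omega>)) * (Z \<omega> * (W d \<omega> - W c \<omega>))) =
      expectation (\<lambda>\<omega>. Y \<omega> * Z \<omega>) * max 0 (min b d - max a c)"
proof -
  define e where "e = max a c"
  have YZ: "bounded_past e (\<lambda>\<omega>. Y \<omega> * Z \<omega>)"
    using Y Z by (auto simp: e_def intro!: bounded_past_mult elim: bounded_past_mono)
  have eq: "(Y \<omega> * (W b \<omega> - W a \<omega>)) * (Z \<omega> * (W d \<omega> - W c \<omega>)) =
      Y \<omega> * Z \<omega> * (W b \<omega> - W a \<omega>) * (W d \<omega> - W c \<omega>)" for \<omega> by simp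
  have eq': "(Y \<omega> * (W b \<omega> - W a \<omega>)) * (Z \<omega> * (W d \<omega> - W c \<omega>)) =
      Y \<omega> * Z \<omega> * (W d \<omega> - W c \<omega>) * (W b \<omega> - W a \<omega>)" for \<omega> by simp
  show "integrable M (\<lambda>\<omega>. (Y \<omega> * (W b \<omega> - W a \<omega>)) * (Z \<omega> * (W d \<omega> - W c \<omega>)))"
    unfolding eq by (rule integrable_increment_products[OF YZ ord])
  show "expectation (\<lambda>\<omega>. (Y \<omega> * (W b \<omega> - W a \<omega>)) * (Z \<omega> * (W d \<omega> - W c \<omega>))) =
      expectation (\<lambda>\<omega>. Y \<omega> * Z \<omega>) * max 0 (min b d - max a c)"
  proof (cases "a \<le> c")
    case True
    then show ?thesis
      unfolding eq using expectation_increments_ordered[of c _ a b d] YZ ord by (simp add: e_def max_def)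
  next
    case False
    then show ?thesis
      unfolding eq' using expectation_increments_ordered[of a _ c d b] YZ ord
      by (simp add: e_def max_def min.commute)
  qed
qed

end

text \<open>The time side of the isometry: the same overlap length that is the covariance of the two
  increments.\<close>

lemma integral_indicator_Ioc_Int:
  fixes a b c d :: real
  shows "integrable lborel (\<lambda>s. indicator {a<..b} s * indicator {c<..d} s :: real)"
    and "(\<integral>s. indicator {a<..b} s * indicator {c<..d} s \<partial>lborel) = max 0 (min b d - max a c)"
proof -
  have eq: "(\<lambda>s. indicator {a<..b} s * indicator {c<..d} s :: real) = indicator {max a c<..min b d}"
    by (auto simp: indicator_def fun_eq_iff)
  show "integrable lborel (\<lambda>s. indicator {a<..b} s * indicator {c<..d} s :: real)"
    unfolding eq by (cases "max a c \<le> min b d") (auto simp: integrable_indicator_iff emeasure_lborel_Ioc)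
  show "(\<integral>s. indicator {a<..b} s * indicator {c<..d} s \<partial>lborel) = max 0 (min b d - max a c)"
    unfolding eq by (cases "max a c \<le> min b d") (auto simp: measure_def emeasure_lborel_Ioc)
qed

context switched_wiener
begin

text \<open>Expanding both squares gives the same double sum of E[Z_i Z_j] times the overlap of the
  i-th and j-th intervals. Since the intervals may overlap freely, no partition has to be refined
  when two simple processes are compared.\<close>

lemma ito_isometry_sum:
  assumes I: "finite I"
    and Z: "\<And>i. i \<in> I \<Longrightarrow> bounded_past (a i) (Z i)"
    and ab: "\<And>i. i \<in> I \<Longrightarrow> 0 \<le> a i \<and> a i \<le> b i \<and> b i \<le> T"
  shows "(\<integral>\<^sup>+\<omega>. ennreal ((\<Sum>i\<in>I. Z i \<omega> * (W (b i) \<omega> - W (a i) \<omega>))\<^sup>2) \<partial>M) =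
    (\<integral>\<^sup>+\<omega>. (\<integral>\<^sup>+s\<in>{0..T}. ennreal ((\<Sum>i\<in>I. Z i \<omega> * indicator {a i<..b i} s)\<^sup>2) \<partial>lborel) \<partial>M)"
proof -
  let ?ov = "\<lambda>i j. max 0 (min (b i) (b j) - max (a i) (a j))"
  let ?f = "\<lambda>i \<omega>. Z i \<omega> * (W (b i) \<omega> - W (a i) \<omega>)"
  have sq: "(\<Sum>i\<in>I. g i)\<^sup>2 = (\<Sum>i\<in>I. \<Sum>j\<in>I. g i * g j)" for g :: "_ \<Rightarrow> real"
    by (simp add: power2_eq_square sum_product)
  have prod: "integrable M (\<lambda>\<omega>. ?f i \<omega> * ?f j \<omega>)"
    "expectation (\<lambda>\<omega>. ?f i \<omega> * ?f j \<omega>) = expectation (\<lambda>\<omega>. Z i \<omega> * Z j \<omega>) * ?ov i j"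
    if "i \<in> I" "j \<in> I" for i j
    using expectation_increment_products[OF Z Z] that ab by auto
  have ZZ: "integrable M (\<lambda>\<omega>. Z i \<omega> * Z j \<omega>)" if "i \<in> I" "j \<in> I" for i j
  proof -
    have "bounded_past (max (a i) (a j)) (Z i)" "bounded_past (max (a i) (a j)) (Z j)"
      using bounded_past_mono[OF Z[OF that(1)]] bounded_past_mono[OF Z[OF that(2)]] by simp_all
    then show ?thesis by (intro bounded_past_integrable bounded_past_mult)
  qed
  have inner: "(\<integral>\<^sup>+s\<in>{0..T}. ennreal ((\<Sum>i\<in>I. Z i \<omega> * indicator {a i<..b i} s)\<^sup>2) \<partial>lborel) =
      ennreal (\<Sum>i\<in>I. \<Sum>j\<in>I. Z i \<omega> * Z j \<omega> * ?ov i j)" for \<omega>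
  proof -
    let ?h = "\<lambda>s. \<Sum>i\<in>I. \<Sum>j\<in>I. (Z i \<omega> * Z j \<omega>) * (indicator {a i<..b i} s * indicator {a j<..b j} s) :: real"
    have h: "(\<Sum>i\<in>I. Z i \<omega> * indicator {a i<..b i} s)\<^sup>2 = ?h s" for s
      unfolding sq by (simp add: mult_ac)
    have int: "integrable lborel ?h"
      by (intro Bochner_Integration.integrable_sum integrable_mult_right integral_indicator_Ioc_Int)
    have "(\<integral>\<^sup>+s\<in>{0..T}. ennreal ((\<Sum>i\<in>I. Z i \<omega> * indicator {a i<..b i} s)\<^sup>2) \<partial>lborel) =
        (\<integral>\<^sup>+s. ennreal (?h s) \<partial>lborel)"
    proof (rule nn_integral_cong)
      fix s :: real
      show "ennreal ((\<Sum>i\<in>I. Z i \<omega> * indicator {a i<..b i} s)\<^sup>2) * indicator {0..T} s = ennreal (?h s)"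
      proof (cases "s \<in> {0..T}")
        case False
        then have "indicator {a i<..b i} s = (0::real)" if "i \<in> I" for i
          using ab[OF that] by (auto simp: indicator_def)
        then have "(\<Sum>i\<in>I. Z i \<omega> * indicator {a i<..b i} s) = 0" by simp
        then show ?thesis unfolding h[symmetric] by simp
      qed (simp add: h)
    qed
    also have "\<dots> = ennreal (\<integral>s. ?h s \<partial>lborel)"
      by (rule nn_integral_eq_integral[OF int]) (simp add: h[symmetric])
    also have "(\<integral>s. ?h s \<partial>lborel) = (\<Sum>i\<in>I. \<Sum>j\<in>I. Z i \<omega> * Z j \<omega> * ?ov i j)"
      by (subst Bochner_Integration.integral_sum
          | intro Bochner_Integration.integrable_sum integrable_mult_right integral_indicator_Ioc_Int sum.cong refl
          | simp add: integral_indicator_Ioc_Int)+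
    finally show ?thesis .
  qed
  \<comment> \<open>The quadratic form is the integral of a square. Pointwise nonnegativity is what
    allows its expectation to be turned into a nonnegative integral, where \<open>ennreal\<close>
    would cut off negative values.\<close>
  have nonneg: "0 \<le> (\<Sum>i\<in>I. \<Sum>j\<in>I. Z i \<omega> * Z j \<omega> * ?ov i j)" for \<omega>
  proof -
    have "(\<Sum>i\<in>I. \<Sum>j\<in>I. Z i \<omega> * Z j \<omega> * ?ov i j) =
        (\<integral>s. (\<Sum>i\<in>I. Z i \<omega> * indicator {a i<..b i} s)\<^sup>2 \<partial>lborel)"
      unfolding sq
      by (subst Bochner_Integration.integral_sum
          | intro Bochner_Integration.integrable_sum sum.cong refl
          | simp add: mult_ac integral_indicator_Ioc_Int)+
    then show ?thesis by simp
  qed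
  have "(\<integral>\<^sup>+\<omega>. ennreal ((\<Sum>i\<in>I. ?f i \<omega>)\<^sup>2) \<partial>M) =
      ennreal (expectation (\<lambda>\<omega>. \<Sum>i\<in>I. \<Sum>j\<in>I. ?f i \<omega> * ?f j \<omega>))"
    unfolding sq[symmetric]
    by (rule nn_integral_eq_integral) (unfold sq, intro Bochner_Integration.integrable_sum prod, auto simp flip: sq)
  also have "expectation (\<lambda>\<omega>. \<Sum>i\<in>I. \<Sum>j\<in>I. ?f i \<omega> * ?f j \<omega>) =
      (\<Sum>i\<in>I. \<Sum>j\<in>I. expectation (\<lambda>\<omega>. Z i \<omega> * Z j \<omega>) * ?ov i j)"
    using prod by (simp add: Bochner_Integration.integral_sum Bochner_Integration.integrable_sum cong: sum.cong)
  also have "\<dots> = expectation (\<lambda>\<omega>. \<Sum>i\<in>I. \<Sum>j\<in>I. Z i \<omega> * Z j \<omega> * ?ov i j)"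
    using ZZ by (simp add: Bochner_Integration.integral_sum Bochner_Integration.integrable_sum cong: sum.cong)
  also have "ennreal \<dots> = (\<integral>\<^sup>+\<omega>. ennreal (\<Sum>i\<in>I. \<Sum>j\<in>I. Z i \<omega> * Z j \<omega> * ?ov i j) \<partial>M)"
    using ZZ nonneg
    by (intro nn_integral_eq_integral[symmetric] Bochner_Integration.integrable_sum integrable_mult_left) auto
  finally show ?thesis unfolding inner .
qed

end

subsection \<open>Approximation by left-endpoint sums\<close>

text \<open>The parallelogram identity with the square of the sum dropped. In \<open>ennreal\<close>
  this serves as a triangle inequality, at the price of a factor 2, for integrals not yet known to
  be finite.\<close>

lemma ennreal_square_diff_le:
  fixes x y z :: real
  shows "ennreal ((x - y)\<^sup>2) \<le> 2 * ennreal ((x - z)\<^sup>2) + 2 * ennreal ((y - z)\<^sup>2)"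
proof -
  have "(x - y)\<^sup>2 + ((x - z) + (y - z))\<^sup>2 = 2 * (x - z)\<^sup>2 + 2 * (y - z)\<^sup>2"
    by (simp add: power2_eq_square algebra_simps)
  then have "(x - y)\<^sup>2 \<le> 2 * (x - z)\<^sup>2 + 2 * (y - z)\<^sup>2"
    by (smt (verit) zero_le_power2)
  then have "ennreal ((x - y)\<^sup>2) \<le> ennreal (2 * (x - z)\<^sup>2 + 2 * (y - z)\<^sup>2)"
    by (rule ennreal_leI)
  also have "\<dots> = 2 * ennreal ((x - z)\<^sup>2) + 2 * ennreal ((y - z)\<^sup>2)"
    by (simp add: ennreal_plus ennreal_mult)
  finally show ?thesis .
qed

lemma nn_integral_square_diff_le:
  fixes f g h :: "'a \<Rightarrow> real"
  assumes [measurable]: "f \<in> borel_measurable M" "g \<in> borel_measurable M" "h \<in> borel_measurable M"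
  shows "(\<integral>\<^sup>+x. ennreal ((f x - g x)\<^sup>2) \<partial>M) \<le>
    2 * (\<integral>\<^sup>+x. ennreal ((f x - h x)\<^sup>2) \<partial>M) + 2 * (\<integral>\<^sup>+x. ennreal ((g x - h x)\<^sup>2) \<partial>M)"
proof -
  have "(\<integral>\<^sup>+x. ennreal ((f x - g x)\<^sup>2) \<partial>M) \<le>
      (\<integral>\<^sup>+x. 2 * ennreal ((f x - h x)\<^sup>2) + 2 * ennreal ((g x - h x)\<^sup>2) \<partial>M)"
    by (intro nn_integral_mono ennreal_square_diff_le)
  also have "\<dots> = 2 * (\<integral>\<^sup>+x. ennreal ((f x - h x)\<^sup>2) \<partial>M) + 2 * (\<integral>\<^sup>+x. ennreal ((g x - h x)\<^sup>2) \<partial>M)"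
    by (simp add: nn_integral_add nn_integral_cmult)
  finally show ?thesis .
qed

lemma borel_measurable_simple_process:
  assumes "\<And>i. i < n \<Longrightarrow> \<xi> i \<in> borel_measurable M"
  shows "(\<lambda>(\<omega>, s). simple_process n p \<xi> s \<omega>) \<in> borel_measurable (M \<Otimes>\<^sub>M restrict_space lborel S)"
proof -
  have "(\<lambda>x. \<xi> i (fst x) * indicator {p i<..p (Suc i)} (snd x))
      \<in> borel_measurable (M \<Otimes>\<^sub>M restrict_space lborel S)" if "i < n" for i
  proof -
    note assms[OF that, measurable]
    have [measurable]: "indicator {p i<..p (Suc i)} \<in> borel_measurable (restrict_space lborel S)"
      by (intro measurable_restrict_space1) simp
    show ?thesis by measurable
  qed
  then show ?thesis unfolding simple_process_def case_prod_beta by (intro borel_measurable_sum) auto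
qed

lemma partition_mono:
  fixes p :: "nat \<Rightarrow> 'a::preorder"
  assumes "\<And>i. i < n \<Longrightarrow> p i \<le> p (Suc i)" "i \<le> j" "j \<le> n"
  shows "p i \<le> p j"
  using assms(2,3)
proof (induction rule: dec_induct)
  case (step k)
  then have "p i \<le> p k" "p k \<le> p (Suc k)" using assms(1) by auto
  then show ?case by (rule order_trans)
qed simp

lemma simple_process_eq:
  assumes mono: "\<And>i. i < n \<Longrightarrow> p i \<le> p (Suc i)" and k: "k < n" and s: "s \<in> {p k<..p (Suc k)}"
  shows "simple_process n p \<xi> s \<omega> = \<xi> k \<omega>"
proof -
  have le: "p i \<le> p j" if "i \<le> j" "j \<le> n" for i j
    using mono that by (rule partition_mono)
  have "indicator {p i<..p (Suc i)} s = (if i = k then 1 else 0 :: real)" if "i < n" for i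
    using le[of "Suc i" k] le[of "Suc k" i] that k s by (cases i k rule: linorder_cases) auto
  then have "simple_process n p \<xi> s \<omega> = (\<Sum>i<n. if i = k then \<xi> i \<omega> else 0)"
    unfolding simple_process_def by (intro sum.cong) auto
  then show ?thesis using k by simp
qed

context switched_wiener
begin

lemma ito_isometry_simple_diff:
  assumes T: "simple_adapted past T n p \<xi>" "simple_adapted past T m q \<eta>"
  shows "(\<integral>\<^sup>+\<omega>. ennreal ((simple_ito_integral W n p \<xi> \<omega> - simple_ito_integral W m q \<eta> \<omega>)\<^sup>2) \<partial>M) =
    (\<integral>\<^sup>+\<omega>. (\<integral>\<^sup>+s\<in>{0..T}. ennreal ((simple_process n p \<xi> s \<omega> - simple_process m q \<eta> s \<omega>)\<^sup>2) \<partial>lborel) \<partial>M)"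
proof -
  have bounds: "0 \<le> r i \<and> r i \<le> r (Suc i) \<and> r (Suc i) \<le> T" "bounded_past (r i) (\<zeta> i)"
    if "simple_adapted past T l r \<zeta>" "i < l" for r l \<zeta> i
  proof -
    show "0 \<le> r i \<and> r i \<le> r (Suc i) \<and> r (Suc i) \<le> T"
      using partition_mono[of l r 0 i] partition_mono[of l r "Suc i" l] that unfolding simple_adapted_def by auto
    show "bounded_past (r i) (\<zeta> i)"
      using that unfolding simple_adapted_def bounded_past_def by auto
  qed
  \<comment> \<open>The disjoint union lists the intervals of both partitions side by side, the
    second family with its sign reversed.\<close>
  let ?I = "{..<n} <+> {..<m}"
  let ?a = "case_sum p q" and ?b = "case_sum (\<lambda>i. p (Suc i)) (\<lambda>i. q (Suc i))"
  let ?Z = "case_sum \<xi> (\<lambda>i \<omega>. - \<eta> i \<omega>)"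
  have "(\<integral>\<^sup>+\<omega>. ennreal ((\<Sum>i\<in>?I. ?Z i \<omega> * (W (?b i) \<omega> - W (?a i) \<omega>))\<^sup>2) \<partial>M) =
    (\<integral>\<^sup>+\<omega>. (\<integral>\<^sup>+s\<in>{0..T}. ennreal ((\<Sum>i\<in>?I. ?Z i \<omega> * indicator {?a i<..?b i} s)\<^sup>2) \<partial>lborel) \<partial>M)"
  proof (rule ito_isometry_sum)
    show "bounded_past (?a i) (?Z i)" if "i \<in> ?I" for i
      using that bounds(2)[OF T(1)] bounds(2)[OF T(2)]
      by (auto intro!: bounded_past_uminus simp del: abs_minus_cancel)
    show "0 \<le> ?a i \<and> ?a i \<le> ?b i \<and> ?b i \<le> T" if "i \<in> ?I" for i
      using that bounds(1)[OF T(1)] bounds(1)[OF T(2)] by auto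
  qed simp
  then show ?thesis
    by (simp only: sum.Plus finite_lessThan comp_def sum.case mult_minus_left sum_negf
        add_uminus_conv_diff simple_ito_integral_def simple_process_def)
qed

text \<open>The squared cosines are 1 and the sines vanish, so the square is 2 - 2 cos(N s - N a)
  almost surely. Its mean is 2 - 2 exp(-2 lam (s - a)), and exp(-z) is at least 1 - z.\<close>

lemma nn_integral_cos_N_diff:
  assumes as: "0 \<le> a" "a \<le> s"
  shows "(\<integral>\<^sup>+\<omega>. ennreal ((cos (N a \<omega>) - cos (N s \<omega>))\<^sup>2) \<partial>M) \<le> ennreal (4 * lam * (s - a))"
proof -
  have [measurable]: "N a \<in> borel_measurable M" "N s \<in> borel_measurable M"
    using N_measurable as by auto
  have int: "integrable M (\<lambda>\<omega>. cos (N s \<omega> - N a \<omega>))"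
    by (intro integrable_const_bound[where B=1]) auto
  have "AE \<omega> in M. (cos (N a \<omega>) - cos (N s \<omega>))\<^sup>2 = 2 - 2 * cos (N s \<omega> - N a \<omega>)"
    using sin_N
  proof eventually_elim
    case (elim \<omega>)
    then have "sin (N a \<omega>) = 0" "sin (N s \<omega>) = 0" using as by auto
    moreover from this have "(cos (N a \<omega>))\<^sup>2 = 1" "(cos (N s \<omega>))\<^sup>2 = 1"
      by (simp_all add: cos_squared_eq)
    ultimately show ?case by (simp add: cos_diff power2_diff)
  qed
  then have "(\<integral>\<^sup>+\<omega>. ennreal ((cos (N a \<omega>) - cos (N s \<omega>))\<^sup>2) \<partial>M) =
      (\<integral>\<^sup>+\<omega>. ennreal (2 - 2 * cos (N s \<omega> - N a \<omega>)) \<partial>M)"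
    by (intro nn_integral_cong_AE) (auto elim: eventually_mono)
  also have "\<dots> = ennreal (expectation (\<lambda>\<omega>. 2 - 2 * cos (N s \<omega> - N a \<omega>)))"
    using int by (intro nn_integral_eq_integral) auto
  also have "expectation (\<lambda>\<omega>. 2 - 2 * cos (N s \<omega> - N a \<omega>)) = 2 - 2 * exp (- (2 * lam * (s - a)))"
    using int N_increment_expectation_cos[OF as] by (simp add: prob_space)
  also have "\<dots> \<le> 4 * lam * (s - a)"
    using exp_ge_add_one_self[of "- (2 * lam * (s - a))"] by simp
  finally show ?thesis by (simp add: ennreal_leI)
qed

text \<open>The left-endpoint step process lies within O(1/n) of the integrand in mean square, and
  the isometry moves this to the integrals. In the constant 16, one factor 4 comes from two triangle
  inequalities with factor 2, the other from \<open>nn_integral_cos_N_diff\<close>.\<close>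

lemma left_endpoint_sums:
  fixes c d T :: real and X :: "'a \<Rightarrow> real"
  defines "f \<equiv> \<lambda>s \<omega>. c + d * cos (N s \<omega>)"
  assumes X: "has_ito_integral M past W T f X" and T: "0 \<le> T" and n: "0 < n"
  shows "(\<integral>\<^sup>+\<omega>. ennreal (((\<Sum>k<n. f (real k * T / real n) \<omega> *
        (W (real (Suc k) * T / real n) \<omega> - W (real k * T / real n) \<omega>)) - X \<omega>)\<^sup>2) \<partial>M) \<le>
    ennreal (16 * d\<^sup>2 * lam * T\<^sup>2 / real n)"
proof -
  define r where "r k = real k * T / real n" for k
  define \<eta> where "\<eta> k = f (r k)" for k
  define R where "R = restrict_space lborel {0..T}"
  have r: "r 0 = 0" "r n = T" "0 \<le> r k" "r k \<le> r (Suc k)" "r (Suc k) - r k = T / real n" for k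
    using T n by (auto simp: r_def field_simps)
  have left: "simple_adapted past T n r \<eta>"
    unfolding simple_adapted_def
  proof (intro conjI allI impI r)
    fix i assume "i < n"
    have "N (r i) \<in> borel_measurable (past (r i))" using N_past[of "r i" "r i"] r by simp
    then show "\<eta> i \<in> borel_measurable (past (r i))" unfolding \<eta>_def f_def by measurable
    show "\<exists>C. \<forall>\<omega>\<in>space (past (r i)). \<bar>\<eta> i \<omega>\<bar> \<le> C"
    proof (intro exI ballI)
      fix \<omega>
      have "\<bar>d * cos (N (r i) \<omega>)\<bar> \<le> \<bar>d\<bar> * 1" unfolding abs_mult by (intro mult_left_mono) auto
      then show "\<bar>\<eta> i \<omega>\<bar> \<le> \<bar>c\<bar> + \<bar>d\<bar>" unfolding \<eta>_def f_def by linarith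
    qed
  qed
  obtain m p \<xi> where adapted: "\<And>k. simple_adapted past T (m k) (p k) (\<xi> k)"
    and lim_f: "(\<lambda>k. \<integral>\<^sup>+\<omega>. (\<integral>\<^sup>+s\<in>{0..T}.
           ennreal ((simple_process (m k) (p k) (\<xi> k) s \<omega> - f s \<omega>)\<^sup>2) \<partial>lborel) \<partial>M) \<longlonglongrightarrow> 0"
    and lim_X: "(\<lambda>k. \<integral>\<^sup>+\<omega>. ennreal ((simple_ito_integral W (m k) (p k) (\<xi> k) \<omega> - X \<omega>)\<^sup>2) \<partial>M) \<longlonglongrightarrow> 0"
    using X unfolding has_ito_integral_def by blast
  have X_meas [measurable]: "X \<in> borel_measurable M" using X by (simp add: has_ito_integral_def)
  have R_int: "(\<integral>\<^sup>+s\<in>{0..T}. g s \<partial>lborel) = (\<integral>\<^sup>+s. g s \<partial>R)" for g :: "real \<Rightarrow> ennreal"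
    unfolding R_def by (simp add: nn_integral_restrict_space)
  interpret R: finite_measure R
    unfolding R_def by (rule finite_measureI) (use T in \<open>simp add: emeasure_restrict_space space_restrict_space\<close>)
  have "(\<lambda>(s, \<omega>). f s \<omega>) \<in> borel_measurable (restrict_space borel {0..T} \<Otimes>\<^sub>M M)"
    using X by (simp add: has_ito_integral_def)
  also have "borel_measurable (restrict_space borel {0..T} \<Otimes>\<^sub>M M) = borel_measurable (R \<Otimes>\<^sub>M M)"
    unfolding R_def by (intro measurable_cong_sets sets_pair_measure_cong sets_restrict_space_cong) auto
  finally have "(\<lambda>(s, \<omega>). f s \<omega>) \<in> borel_measurable (R \<Otimes>\<^sub>M M)" .
  from measurable_pair_swap[OF this]
  have f_meas [measurable]: "(\<lambda>(\<omega>, s). f s \<omega>) \<in> borel_measurable (M \<Otimes>\<^sub>M R)" by simp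
  have \<xi>_meas: "\<zeta> i \<in> borel_measurable M" if "simple_adapted past T l q \<zeta>" "i < l" for l q \<zeta> i
    using that unfolding simple_adapted_def by (blast intro: past_measurable)
  have sp_meas: "(\<lambda>(\<omega>, s). simple_process l q \<zeta> s \<omega>) \<in> borel_measurable (M \<Otimes>\<^sub>M R)"
    if "simple_adapted past T l q \<zeta>" for l q \<zeta>
    unfolding R_def by (rule borel_measurable_simple_process) (rule \<xi>_meas[OF that])
  have iterated: "(\<integral>\<^sup>+\<omega>. (\<integral>\<^sup>+s. g s \<omega> \<partial>R) \<partial>M) = (\<integral>\<^sup>+x. (case x of (\<omega>, s) \<Rightarrow> g s \<omega>) \<partial>(M \<Otimes>\<^sub>M R))"
    if "(\<lambda>(\<omega>, s). g s \<omega>) \<in> borel_measurable (M \<Otimes>\<^sub>M R)" for g :: "real \<Rightarrow> 'a \<Rightarrow> ennreal"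
    using R.nn_integral_fst[OF that] by simp
  \<comment> \<open>The squared distance from the left-endpoint process to the integrand itself; the
    defining sequence of \<open>X\<close> does not enter it.\<close>
  define \<epsilon> where "\<epsilon> = (\<integral>\<^sup>+\<omega>. (\<integral>\<^sup>+s. ennreal ((simple_process n r \<eta> s \<omega> - f s \<omega>)\<^sup>2) \<partial>R) \<partial>M)"
  have tri: "(\<integral>\<^sup>+\<omega>. (\<integral>\<^sup>+s. ennreal ((simple_process n r \<eta> s \<omega> - simple_process (m k) (p k) (\<xi> k) s \<omega>)\<^sup>2) \<partial>R) \<partial>M)
    \<le> 2 * \<epsilon> + 2 * (\<integral>\<^sup>+\<omega>. (\<integral>\<^sup>+s. ennreal ((simple_process (m k) (p k) (\<xi> k) s \<omega> - f s \<omega>)\<^sup>2) \<partial>R) \<partial>M)" for k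
  proof -
    note [measurable] = sp_meas[OF left] sp_meas[OF adapted[of k]]
    show ?thesis unfolding \<epsilon>_def
      using nn_integral_square_diff_le[OF sp_meas[OF left] sp_meas[OF adapted[of k]] f_meas]
      by (subst (1 2 3) iterated) (measurable, simp add: split_beta')
  qed
  define S where "S = simple_ito_integral W n r \<eta>"
  have I_meas: "simple_ito_integral W l q \<zeta> \<in> borel_measurable M" if "simple_adapted past T l q \<zeta>" for l q \<zeta>
  proof -
    have ge0: "0 \<le> q i" if "i \<le> l" for i
      using partition_mono[of l q 0 i] that \<open>simple_adapted past T l q \<zeta>\<close>
      by (simp add: simple_adapted_def)
    have "(\<lambda>\<omega>. \<Sum>i<l. \<zeta> i \<omega> * (W (q (Suc i)) \<omega> - W (q i) \<omega>)) \<in> borel_measurable M"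
      using \<xi>_meas[OF that] ge0
      by (intro borel_measurable_sum borel_measurable_times borel_measurable_diff W_measurable) auto
    then show ?thesis unfolding simple_ito_integral_def[abs_def] .
  qed
  \<comment> \<open>The comparison runs through the k-th member of the defining sequence: from the
    left sum to its integral by the isometry and \<open>tri\<close>, from its integral to
    \<open>X\<close> directly.\<close>
  have S_le: "(\<integral>\<^sup>+\<omega>. ennreal ((S \<omega> - X \<omega>)\<^sup>2) \<partial>M) \<le>
      2 * (2 * \<epsilon> + 2 * (\<integral>\<^sup>+\<omega>. (\<integral>\<^sup>+s. ennreal ((simple_process (m k) (p k) (\<xi> k) s \<omega> - f s \<omega>)\<^sup>2) \<partial>R) \<partial>M)) +
      2 * (\<integral>\<^sup>+\<omega>. ennreal ((simple_ito_integral W (m k) (p k) (\<xi> k) \<omega> - X \<omega>)\<^sup>2) \<partial>M)" for k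
  proof -
    have "(\<integral>\<^sup>+\<omega>. ennreal ((S \<omega> - X \<omega>)\<^sup>2) \<partial>M) \<le>
        2 * (\<integral>\<^sup>+\<omega>. ennreal ((S \<omega> - simple_ito_integral W (m k) (p k) (\<xi> k) \<omega>)\<^sup>2) \<partial>M) +
        2 * (\<integral>\<^sup>+\<omega>. ennreal ((X \<omega> - simple_ito_integral W (m k) (p k) (\<xi> k) \<omega>)\<^sup>2) \<partial>M)"
      unfolding S_def
      by (rule nn_integral_square_diff_le[OF I_meas[OF left] X_meas I_meas[OF adapted[of k]]])
    also have "(\<integral>\<^sup>+\<omega>. ennreal ((S \<omega> - simple_ito_integral W (m k) (p k) (\<xi> k) \<omega>)\<^sup>2) \<partial>M) \<le>
        2 * \<epsilon> + 2 * (\<integral>\<^sup>+\<omega>. (\<integral>\<^sup>+s. ennreal ((simple_process (m k) (p k) (\<xi> k) s \<omega> - f s \<omega>)\<^sup>2) \<partial>R) \<partial>M)"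
      unfolding S_def ito_isometry_simple_diff[OF left adapted[of k]] R_int by (rule tri)
    finally show ?thesis by (simp add: power2_commute[of "X _"] add_mono mult_left_mono)
  qed
  \<comment> \<open>Letting k grow removes the terms of the defining sequence, so only 4 times
    \<open>\<epsilon>\<close> remains.\<close>
  have "(\<lambda>k. 2 * (2 * \<epsilon> + 2 * (\<integral>\<^sup>+\<omega>. (\<integral>\<^sup>+s. ennreal ((simple_process (m k) (p k) (\<xi> k) s \<omega> - f s \<omega>)\<^sup>2) \<partial>R) \<partial>M)) +
      2 * (\<integral>\<^sup>+\<omega>. ennreal ((simple_ito_integral W (m k) (p k) (\<xi> k) \<omega> - X \<omega>)\<^sup>2) \<partial>M))
      \<longlonglongrightarrow> 2 * (2 * \<epsilon> + 2 * 0) + 2 * 0"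
    using lim_f lim_X unfolding R_int
    by (intro tendsto_add ennreal_tendsto_cmult tendsto_const) (auto simp: less_top[symmetric])
  from LIMSEQ_le_const[OF this] have "(\<integral>\<^sup>+\<omega>. ennreal ((S \<omega> - X \<omega>)\<^sup>2) \<partial>M) \<le> 2 * (2 * \<epsilon> + 2 * 0) + 2 * 0"
    using S_le by blast
  also have "\<dots> = 4 * \<epsilon>" by (simp add: mult.assoc[symmetric])
  also have "\<epsilon> \<le> ennreal (4 * d\<^sup>2 * lam * T\<^sup>2 / real n)"
  proof -
    let ?g = "\<lambda>\<omega> s. ennreal ((simple_process n r \<eta> s \<omega> - f s \<omega>)\<^sup>2)"
    interpret MR: pair_sigma_finite M R ..
    have g_meas: "(\<lambda>(\<omega>, s). ?g \<omega> s) \<in> borel_measurable (M \<Otimes>\<^sub>M R)"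
      using sp_meas[OF left] by measurable
    \<comment> \<open>After Fubini the expectation is taken at a fixed time \<open>s\<close>, where
      only N at \<open>s\<close> and at the grid point before it occur.\<close>
    have "\<epsilon> = (\<integral>\<^sup>+s. (\<integral>\<^sup>+\<omega>. ?g \<omega> s \<partial>M) \<partial>R)"
      unfolding \<epsilon>_def using MR.Fubini'[OF g_meas] by simp
    also have "\<dots> \<le> (\<integral>\<^sup>+s. ennreal (4 * d\<^sup>2 * lam * T / real n) \<partial>R)"
    proof (rule nn_integral_mono_AE)
      \<comment> \<open>The half-open cells of a simple process leave out the time 0, where it takes
        the value 0 instead of the integrand.\<close>
      have "AE s in lborel. s \<noteq> (0::real)" by (rule AE_lborel_singleton)
      then have "AE s in R. s \<noteq> 0" unfolding R_def by (auto simp: AE_restrict_space_iff elim: eventually_mono)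
      moreover have "AE s in R. s \<in> {0..T}" unfolding R_def by (intro AE_I2) (simp add: space_restrict_space)
      ultimately show "AE s in R. (\<integral>\<^sup>+\<omega>. ?g \<omega> s \<partial>M) \<le> ennreal (4 * d\<^sup>2 * lam * T / real n)"
      proof eventually_elim
        case (elim s)
        then have s: "0 < s" "s \<le> T" and Tp: "0 < T" by auto
        \<comment> \<open>Ceiling minus 1, rather than floor, since the cells are open on the left:
          a grid point belongs to the cell that ends there.\<close>
        define k where "k = nat (\<lceil>s * real n / T\<rceil> - 1)"
        have "0 < s * real n / T" using s n Tp by simp
        then have k: "real k < s * real n / T" "s * real n / T \<le> real (Suc k)"
          unfolding k_def by linarith+
        have "s * real n / T \<le> real n" using s n Tp by (simp add: field_simps)
        then have kn: "k < n" using k(1) by linarith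
        have sk: "s \<in> {r k<..r (Suc k)}" using k n Tp by (simp add: r_def field_simps)
        have "(\<integral>\<^sup>+\<omega>. ?g \<omega> s \<partial>M) = (\<integral>\<^sup>+\<omega>. ennreal (d\<^sup>2) * ennreal ((cos (N (r k) \<omega>) - cos (N s \<omega>))\<^sup>2) \<partial>M)"
          unfolding simple_process_eq[of n r, OF r(4) kn sk] \<eta>_def f_def
          by (simp add: right_diff_distrib[symmetric] power_mult_distrib ennreal_mult)
        also have "\<dots> = ennreal (d\<^sup>2) * (\<integral>\<^sup>+\<omega>. ennreal ((cos (N (r k) \<omega>) - cos (N s \<omega>))\<^sup>2) \<partial>M)"
        proof -
          have [measurable]: "N (r k) \<in> borel_measurable M" "N s \<in> borel_measurable M"
            using N_measurable r(3) s by auto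
          show ?thesis by (rule nn_integral_cmult) measurable
        qed
        also have "\<dots> \<le> ennreal (d\<^sup>2) * ennreal (4 * lam * (s - r k))"
          using sk r(3) by (intro mult_left_mono nn_integral_cos_N_diff) auto
        also have "\<dots> \<le> ennreal (d\<^sup>2) * ennreal (4 * lam * (T / real n))"
          using sk r(5)[of k] lam_pos by (intro mult_left_mono ennreal_leI) auto
        finally show ?case by (simp add: ennreal_mult[symmetric] T lam_pos less_imp_le mult_ac)
      qed
    qed
    also have "\<dots> = ennreal (4 * d\<^sup>2 * lam * T / real n) * ennreal T"
      using T by (simp add: R_def emeasure_restrict_space space_restrict_space)
    also have "\<dots> = ennreal (4 * d\<^sup>2 * lam * T\<^sup>2 / real n)"
      using T lam_pos by (simp add: ennreal_mult[symmetric] power2_eq_square)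
    finally show ?thesis .
  qed
  also have "4 * ennreal (4 * d\<^sup>2 * lam * T\<^sup>2 / real n) = ennreal (16 * d\<^sup>2 * lam * T\<^sup>2 / real n)"
    using lam_pos by (subst ennreal_numeral[symmetric], subst ennreal_mult[symmetric]) auto
  finally have "(\<integral>\<^sup>+\<omega>. ennreal ((S \<omega> - X \<omega>)\<^sup>2) \<partial>M) \<le> ennreal (16 * d\<^sup>2 * lam * T\<^sup>2 / real n)"
    by (simp add: mult_left_mono)
  then show ?thesis unfolding S_def simple_ito_integral_def \<eta>_def r_def .
qed

end

text \<open>The map x to exp(ix) is 1-Lipschitz, and the first absolute moment is at most the root
  of the second because a variance is nonnegative.\<close>

lemma (in prob_space) norm_expectation_iexp_diff_le:
  fixes X Y :: "'a \<Rightarrow> real"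
  assumes [measurable]: "X \<in> borel_measurable M" "Y \<in> borel_measurable M"
    and le: "(\<integral>\<^sup>+\<omega>. ennreal ((X \<omega> - Y \<omega>)\<^sup>2) \<partial>M) \<le> ennreal c" and c: "0 \<le> c"
  shows "norm ((\<integral>\<omega>. iexp (X \<omega>) \<partial>M) - (\<integral>\<omega>. iexp (Y \<omega>) \<partial>M)) \<le> sqrt c"
proof -
  have sq_int: "integrable M (\<lambda>\<omega>. (X \<omega> - Y \<omega>)\<^sup>2)"
  proof (rule integrableI_nonneg)
    show "(\<integral>\<^sup>+\<omega>. ennreal ((X \<omega> - Y \<omega>)\<^sup>2) \<partial>M) < \<infinity>"
      using le by (rule le_less_trans) simp
  qed simp_all
  then have sq_le: "expectation (\<lambda>\<omega>. (X \<omega> - Y \<omega>)\<^sup>2) \<le> c"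
    using le c by (subst (asm) nn_integral_eq_integral) auto
  have int: "integrable M (\<lambda>\<omega>. \<bar>X \<omega> - Y \<omega>\<bar>)"
    by (rule integrable_abs[OF square_integrable_imp_integrable[OF _ sq_int]]) measurable
  have "0 \<le> variance (\<lambda>\<omega>. \<bar>X \<omega> - Y \<omega>\<bar>)" by (rule variance_positive)
  also have "\<dots> = expectation (\<lambda>\<omega>. (X \<omega> - Y \<omega>)\<^sup>2) - (expectation (\<lambda>\<omega>. \<bar>X \<omega> - Y \<omega>\<bar>))\<^sup>2"
    using int sq_int by (subst variance_eq) auto
  finally have "(expectation (\<lambda>\<omega>. \<bar>X \<omega> - Y \<omega>\<bar>))\<^sup>2 \<le> c" using sq_le by simp
  then have L1: "expectation (\<lambda>\<omega>. \<bar>X \<omega> - Y \<omega>\<bar>) \<le> sqrt c" by (rule real_le_rsqrt)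
  have lip: "norm (iexp x - iexp y) \<le> \<bar>x - y\<bar>" for x y :: real
  proof -
    have "norm (iexp (x - y) - 1) \<le> \<bar>x - y\<bar>"
      using iexp_approx1[of "x - y" 0] by simp
    moreover have "iexp x - iexp y = iexp y * (iexp (x - y) - 1)"
      by (simp add: right_diff_distrib flip: exp_add)
    ultimately show ?thesis by (simp add: norm_mult)
  qed
  have [simp]: "integrable M (\<lambda>\<omega>. iexp (X \<omega>))" "integrable M (\<lambda>\<omega>. iexp (Y \<omega>))"
    by (auto intro!: integrable_const_bound[where B=1])
  have "norm ((\<integral>\<omega>. iexp (X \<omega>) \<partial>M) - (\<integral>\<omega>. iexp (Y \<omega>) \<partial>M)) =
      norm (\<integral>\<omega>. iexp (X \<omega>) - iexp (Y \<omega>) \<partial>M)"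
    by simp
  also have "\<dots> \<le> expectation (\<lambda>\<omega>. norm (iexp (X \<omega>) - iexp (Y \<omega>)))"
    by (rule integral_norm_bound)
  also have "\<dots> \<le> expectation (\<lambda>\<omega>. \<bar>X \<omega> - Y \<omega>\<bar>)"
    using int lip by (intro integral_mono) auto
  finally show ?thesis using L1 by simp
qed

section \<open>Characteristic functions of left-endpoint sums\<close>

context switched_wiener
begin

definition chi :: "real \<Rightarrow> 'a \<Rightarrow> real" where
  "chi t \<omega> = (1 + cos (N t \<omega>)) / 2"

text \<open>The coefficients absorb \<open>b\<close> and the frequencies: (b, 0) and (0, b) give the
  approximations of the two coordinates, (\<alpha> b, \<beta> b) their combination in the
  exponent.\<close>

definition left_sum :: "real \<Rightarrow> real \<Rightarrow> real \<Rightarrow> nat \<Rightarrow> 'a \<Rightarrow> real" where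
  "left_sum A B h n \<omega> = (\<Sum>k<n. (A * chi (real k * h) \<omega> + B * (1 - chi (real k * h) \<omega>)) *
     (W (real (Suc k) * h) \<omega> - W (real k * h) \<omega>))"

lemma chi_past: "0 \<le> t \<Longrightarrow> chi t \<in> borel_measurable (past t)"
  using N_past[of t t] unfolding chi_def[abs_def] by simp

lemma chi_nonneg: "0 \<le> chi t \<omega>"
  using add_left_mono[OF cos_ge_minus_one[of "N t \<omega>"], of 1] by (simp add: chi_def)

lemma chi_le_1: "chi t \<omega> \<le> 1"
  using add_left_mono[OF cos_le_one[of "N t \<omega>"], of 1] by (simp add: chi_def)

lemma left_sum_past:
  assumes "0 \<le> h"
  shows "left_sum A B h n \<in> borel_measurable (past (real n * h))"
proof -
  have "chi (real k * h) \<in> borel_measurable (past (real n * h))"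
    "W (real (Suc k) * h) \<in> borel_measurable (past (real n * h))"
    "W (real k * h) \<in> borel_measurable (past (real n * h))" if "k < n" for k
    using that assms
    by (auto intro!: past_measurable_mono[OF _ chi_past] W_past mult_right_mono simp del: of_nat_Suc)
  then show ?thesis unfolding left_sum_def[abs_def]
    by (intro borel_measurable_sum borel_measurable_times borel_measurable_add borel_measurable_diff) auto
qed

lemma left_sum_measurable: "0 \<le> h \<Longrightarrow> left_sum A B h n \<in> borel_measurable M"
  by (rule past_measurable[OF left_sum_past])

lemma expectation_left_sum_tendsto:
  assumes T: "0 \<le> T"
    and X: "has_ito_integral M past W T (\<lambda>t \<omega>. chi t \<omega> * b) X"
    and Y: "has_ito_integral M past W T (\<lambda>t \<omega>. (1 - chi t \<omega>) * b) Y"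
  shows "(\<lambda>n. \<integral>\<omega>. iexp (left_sum (\<alpha> * b) (\<beta> * b) (T / real n) n \<omega>) \<partial>M) \<longlonglongrightarrow>
    (\<integral>\<omega>. iexp (\<alpha> * X \<omega> + \<beta> * Y \<omega>) \<partial>M)"
proof -
  have [measurable]: "X \<in> borel_measurable M" "Y \<in> borel_measurable M"
    using X Y by (simp_all add: has_ito_integral_def)
  \<comment> \<open>Each coordinate has \<open>d = b / 2\<close> up to sign, so its error is 16
    (b/2)^2 lam T^2 / n = 4 b^2 lam T^2 / n; combining the two with weights \<alpha>^2 and \<beta>^2
    costs another factor 2.\<close>
  define K where "K = 8 * (\<alpha>\<^sup>2 + \<beta>\<^sup>2) * b\<^sup>2 * lam * T\<^sup>2"
  have K: "0 \<le> K" using lam_pos by (simp add: K_def)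
  have fX: "(\<lambda>t \<omega>. chi t \<omega> * b) = (\<lambda>s \<omega>. b / 2 + b / 2 * cos (N s \<omega>))"
    by (simp add: chi_def fun_eq_iff field_simps)
  have fY: "(\<lambda>t \<omega>. (1 - chi t \<omega>) * b) = (\<lambda>s \<omega>. b / 2 + (- b / 2) * cos (N s \<omega>))"
    by (simp add: chi_def fun_eq_iff field_simps)
  have bound: "norm ((\<integral>\<omega>. iexp (left_sum (\<alpha> * b) (\<beta> * b) (T / real n) n \<omega>) \<partial>M) -
      (\<integral>\<omega>. iexp (\<alpha> * X \<omega> + \<beta> * Y \<omega>) \<partial>M)) \<le> sqrt (K / real n)" if n: "0 < n" for n
  proof (rule norm_expectation_iexp_diff_le)
    define SX where "SX = left_sum b 0 (T / real n) n"
    define SY where "SY = left_sum 0 b (T / real n) n"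
    have [measurable]: "SX \<in> borel_measurable M" "SY \<in> borel_measurable M"
      unfolding SX_def SY_def using T by (auto intro: left_sum_measurable)
    have split: "left_sum (\<alpha> * b) (\<beta> * b) (T / real n) n \<omega> = \<alpha> * SX \<omega> + \<beta> * SY \<omega>" for \<omega>
      unfolding SX_def SY_def left_sum_def sum_distrib_left sum.distrib[symmetric]
      by (intro sum.cong refl) (simp add: algebra_simps)
    have SX_le: "(\<integral>\<^sup>+\<omega>. ennreal ((SX \<omega> - X \<omega>)\<^sup>2) \<partial>M) \<le> ennreal (4 * b\<^sup>2 * lam * T\<^sup>2 / real n)"
      using left_endpoint_sums[OF X[unfolded fX] T n]
      by (simp add: SX_def left_sum_def chi_def power_divide field_simps)
    have SY_le: "(\<integral>\<^sup>+\<omega>. ennreal ((SY \<omega> - Y \<omega>)\<^sup>2) \<partial>M) \<le> ennreal (4 * b\<^sup>2 * lam * T\<^sup>2 / real n)"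
      using left_endpoint_sums[OF Y[unfolded fY] T n]
      by (simp add: SY_def left_sum_def chi_def power_divide field_simps)
    have "(\<integral>\<^sup>+\<omega>. ennreal (((\<alpha> * SX \<omega> + \<beta> * SY \<omega>) - (\<alpha> * X \<omega> + \<beta> * Y \<omega>))\<^sup>2) \<partial>M) \<le>
        2 * (\<integral>\<^sup>+\<omega>. ennreal (((\<alpha> * SX \<omega> + \<beta> * SY \<omega>) - (\<alpha> * X \<omega> + \<beta> * SY \<omega>))\<^sup>2) \<partial>M) +
        2 * (\<integral>\<^sup>+\<omega>. ennreal (((\<alpha> * X \<omega> + \<beta> * Y \<omega>) - (\<alpha> * X \<omega> + \<beta> * SY \<omega>))\<^sup>2) \<partial>M)"
      by (rule nn_integral_square_diff_le) measurable
    also have "(\<integral>\<^sup>+\<omega>. ennreal (((\<alpha> * SX \<omega> + \<beta> * SY \<omega>) - (\<alpha> * X \<omega> + \<beta> * SY \<omega>))\<^sup>2) \<partial>M) =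
        ennreal (\<alpha>\<^sup>2) * (\<integral>\<^sup>+\<omega>. ennreal ((SX \<omega> - X \<omega>)\<^sup>2) \<partial>M)"
      by (subst nn_integral_cmult[symmetric])
        (auto simp flip: right_diff_distrib simp: power_mult_distrib ennreal_mult)
    also have "(\<integral>\<^sup>+\<omega>. ennreal (((\<alpha> * X \<omega> + \<beta> * Y \<omega>) - (\<alpha> * X \<omega> + \<beta> * SY \<omega>))\<^sup>2) \<partial>M) =
        ennreal (\<beta>\<^sup>2) * (\<integral>\<^sup>+\<omega>. ennreal ((SY \<omega> - Y \<omega>)\<^sup>2) \<partial>M)"
      by (subst nn_integral_cmult[symmetric])
        (auto simp flip: right_diff_distrib simp: power_mult_distrib ennreal_mult power2_commute[of "Y _"])
    also have "2 * (ennreal (\<alpha>\<^sup>2) * (\<integral>\<^sup>+\<omega>. ennreal ((SX \<omega> - X \<omega>)\<^sup>2) \<partial>M)) +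
        2 * (ennreal (\<beta>\<^sup>2) * (\<integral>\<^sup>+\<omega>. ennreal ((SY \<omega> - Y \<omega>)\<^sup>2) \<partial>M)) \<le>
        2 * (ennreal (\<alpha>\<^sup>2) * ennreal (4 * b\<^sup>2 * lam * T\<^sup>2 / real n)) +
        2 * (ennreal (\<beta>\<^sup>2) * ennreal (4 * b\<^sup>2 * lam * T\<^sup>2 / real n))"
      by (intro add_mono mult_left_mono SX_le SY_le) auto
    also have "\<dots> = ennreal (2 * (\<alpha>\<^sup>2 * (4 * b\<^sup>2 * lam * T\<^sup>2 / real n)) + 2 * (\<beta>\<^sup>2 * (4 * b\<^sup>2 * lam * T\<^sup>2 / real n)))"
    proof -
      have "2 * (ennreal p * ennreal q) = ennreal (2 * (p * q))" if "0 \<le> p" "0 \<le> q" for p q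
        using that by (simp add: ennreal_mult)
      then show ?thesis using lam_pos by (subst ennreal_plus) simp_all
    qed
    also have "2 * (\<alpha>\<^sup>2 * (4 * b\<^sup>2 * lam * T\<^sup>2 / real n)) + 2 * (\<beta>\<^sup>2 * (4 * b\<^sup>2 * lam * T\<^sup>2 / real n)) = K / real n"
      by (simp add: K_def add_divide_distrib algebra_simps)
    finally show "(\<integral>\<^sup>+\<omega>. ennreal ((left_sum (\<alpha> * b) (\<beta> * b) (T / real n) n \<omega> - (\<alpha> * X \<omega> + \<beta> * Y \<omega>))\<^sup>2) \<partial>M)
        \<le> ennreal (K / real n)"
      unfolding split .
    show "left_sum (\<alpha> * b) (\<beta> * b) (T / real n) n \<in> borel_measurable M"
      using T by (auto intro: left_sum_measurable)
  qed (use K in auto)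
  have "(\<lambda>n. sqrt (K / real n)) \<longlonglongrightarrow> 0"
    using tendsto_real_sqrt[OF lim_const_over_n[of K]] by simp
  moreover have "\<forall>\<^sub>F n in sequentially. norm ((\<integral>\<omega>. iexp (left_sum (\<alpha> * b) (\<beta> * b) (T / real n) n \<omega>) \<partial>M) -
      (\<integral>\<omega>. iexp (\<alpha> * X \<omega> + \<beta> * Y \<omega>) \<partial>M)) \<le> sqrt (K / real n)"
    using eventually_gt_at_top[of "0::nat"] by eventually_elim (rule bound)
  ultimately have "(\<lambda>n. (\<integral>\<omega>. iexp (left_sum (\<alpha> * b) (\<beta> * b) (T / real n) n \<omega>) \<partial>M) -
      (\<integral>\<omega>. iexp (\<alpha> * X \<omega> + \<beta> * Y \<omega>) \<partial>M)) \<longlonglongrightarrow> 0"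
    by (rule Lim_null_comparison[rotated])
  then show ?thesis by (simp add: LIM_zero_iff)
qed

subsection \<open>The recursion along the grid\<close>

text \<open>The contribution of the paths that diffuse along the x-axis at time
  \<open>real n * h\<close>, since \<open>chi\<close> is almost surely the indicator of that
  event.\<close>

definition xmean :: "real \<Rightarrow> real \<Rightarrow> real \<Rightarrow> nat \<Rightarrow> complex" where
  "xmean A B h n = (\<integral>\<omega>. iexp (left_sum A B h n \<omega>) * complex_of_real (chi (real n * h) \<omega>) \<partial>M)"

definition ymean :: "real \<Rightarrow> real \<Rightarrow> real \<Rightarrow> nat \<Rightarrow> complex" where
  "ymean A B h n = (\<integral>\<omega>. iexp (left_sum A B h n \<omega>) * complex_of_real (1 - chi (real n * h) \<omega>) \<partial>M)"

lemma means_integrable: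
  assumes "0 \<le> h"
  shows "(\<lambda>\<omega>. iexp (left_sum A B h n \<omega>) * complex_of_real (chi (real n * h) \<omega>)) \<in> borel_measurable (past (real n * h))"
    and "(\<lambda>\<omega>. iexp (left_sum A B h n \<omega>) * complex_of_real (1 - chi (real n * h) \<omega>)) \<in> borel_measurable (past (real n * h))"
    and "integrable M (\<lambda>\<omega>. iexp (left_sum A B h n \<omega>) * complex_of_real (chi (real n * h) \<omega>))"
    and "integrable M (\<lambda>\<omega>. iexp (left_sum A B h n \<omega>) * complex_of_real (1 - chi (real n * h) \<omega>))"
proof -
  have [measurable]: "left_sum A B h n \<in> borel_measurable (past (real n * h))"
      "chi (real n * h) \<in> borel_measurable (past (real n * h))"
    using left_sum_past[OF assms] chi_past[of "real n * h"] assms by auto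
  show 1: "(\<lambda>\<omega>. iexp (left_sum A B h n \<omega>) * complex_of_real (chi (real n * h) \<omega>)) \<in> borel_measurable (past (real n * h))"
    and 2: "(\<lambda>\<omega>. iexp (left_sum A B h n \<omega>) * complex_of_real (1 - chi (real n * h) \<omega>)) \<in> borel_measurable (past (real n * h))"
    by measurable
  have "norm (iexp (left_sum A B h n \<omega>) * complex_of_real (chi (real n * h) \<omega>)) \<le> 1"
    "norm (iexp (left_sum A B h n \<omega>) * complex_of_real (1 - chi (real n * h) \<omega>)) \<le> 1" for \<omega>
    using chi_nonneg[of "real n * h" \<omega>] chi_le_1[of "real n * h" \<omega>] by (simp_all only: norm_mult norm_of_real norm_exp_i_times) simp_all
  then show "integrable M (\<lambda>\<omega>. iexp (left_sum A B h n \<omega>) * complex_of_real (chi (real n * h) \<omega>))"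
    "integrable M (\<lambda>\<omega>. iexp (left_sum A B h n \<omega>) * complex_of_real (1 - chi (real n * h) \<omega>))"
    using past_measurable[OF 1] past_measurable[OF 2]
    by (auto intro!: integrable_const_bound[where B=1])
qed

lemma means_0: "xmean A B h 0 = 1" "ymean A B h 0 = 0"
proof -
  have [measurable]: "N 0 \<in> borel_measurable M" by (rule N_measurable) simp
  have "xmean A B h 0 = (\<integral>\<omega>. 1 \<partial>M)"
    unfolding xmean_def left_sum_def chi_def using N0
    by (intro integral_cong_AE) (auto elim: eventually_mono)
  then show "xmean A B h 0 = 1" by (simp add: prob_space)
  have "ymean A B h 0 = (\<integral>\<omega>. 0 \<partial>M)"
    unfolding ymean_def left_sum_def chi_def using N0
    by (intro integral_cong_AE) (auto elim: eventually_mono)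
  then show "ymean A B h 0 = 0" by simp
qed

lemma means_add: "0 \<le> h \<Longrightarrow> xmean A B h n + ymean A B h n = (\<integral>\<omega>. iexp (left_sum A B h n \<omega>) \<partial>M)"
  unfolding xmean_def ymean_def
    Bochner_Integration.integral_add[OF means_integrable(3,4), symmetric]
  by (simp flip: distrib_left)

text \<open>If \<open>chi\<close> is 1 at the old grid point, the new phase factor uses
  \<open>A\<close> and \<open>chi\<close> remains 1 exactly when the number of jumps is even; if it
  is 0, the factor uses \<open>B\<close> and \<open>chi\<close> becomes 1 exactly when that number
  is odd. Each of the four cases is one application of \<open>past_times_phase\<close>.\<close>

lemma means_Suc:
  assumes h: "0 \<le> h"
  defines "e \<equiv> exp (- (2 * lam * h))"
  shows "xmean A B h (Suc n) =
      complex_of_real (exp (- (A\<^sup>2 * h / 2)) * ((1 + e) / 2)) * xmean A B h n +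
      complex_of_real (exp (- (B\<^sup>2 * h / 2)) * ((1 - e) / 2)) * ymean A B h n" (is ?x)
    and "ymean A B h (Suc n) =
      complex_of_real (exp (- (A\<^sup>2 * h / 2)) * ((1 - e) / 2)) * xmean A B h n +
      complex_of_real (exp (- (B\<^sup>2 * h / 2)) * ((1 + e) / 2)) * ymean A B h n" (is ?y)
proof -
  define r where "r = real n * h"
  define r' where "r' = real (Suc n) * h"
  have r: "0 \<le> r" "r \<le> r'" "r' - r = h" using h by (auto simp: r_def r'_def algebra_simps)
  let ?S = "\<lambda>n \<omega>. iexp (left_sum A B h n \<omega>)"
  let ?X = "\<lambda>\<omega>. ?S n \<omega> * complex_of_real (chi r \<omega>)"
  let ?Y = "\<lambda>\<omega>. ?S n \<omega> * complex_of_real (1 - chi r \<omega>)"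
  let ?P = "\<lambda>c d \<omega>. iexp (c * (W r' \<omega> - W r \<omega>)) * complex_of_real ((1 + d * cos (N r' \<omega> - N r \<omega>)) / 2)"
  note int = means_integrable[OF h, of A B n, folded r_def]
  note X = past_times_phase[OF r(1,2) int(1,3)]
  note Y = past_times_phase[OF r(1,2) int(2,4)]
  \<comment> \<open>With sin(N r) = 0 the addition formula reads cos(N r' - N r) = cos(N r') cos(N
    r), and cos(N r) is a sign.\<close>
  have cases: "AE \<omega> in M. (cos (N r \<omega>) = 1 \<and> cos (N r' \<omega> - N r \<omega>) = cos (N r' \<omega>)) \<or>
      (cos (N r \<omega>) = - 1 \<and> cos (N r' \<omega> - N r \<omega>) = - cos (N r' \<omega>))"
    using sin_N
  proof eventually_elim
    case (elim \<omega>)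
    then have s: "sin (N r \<omega>) = 0" using r by auto
    then have "(cos (N r \<omega>))\<^sup>2 = 1" by (simp add: cos_squared_eq)
    then have "cos (N r \<omega>) = 1 \<or> cos (N r \<omega>) = - 1" by (simp add: power2_eq_1_iff)
    then show ?case using s by (auto simp: cos_diff)
  qed
  have S_Suc: "?S (Suc n) \<omega> =
      ?S n \<omega> * iexp ((A * chi r \<omega> + B * (1 - chi r \<omega>)) * (W r' \<omega> - W r \<omega>))" for \<omega>
    unfolding left_sum_def sum.lessThan_Suc r_def[symmetric] r'_def[symmetric] of_real_add distrib_left exp_add ..
  have meas: "integrable M (\<lambda>\<omega>. ?S (Suc n) \<omega> * complex_of_real (chi r' \<omega>))"
    "integrable M (\<lambda>\<omega>. ?S (Suc n) \<omega> * complex_of_real (1 - chi r' \<omega>))"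
    using means_integrable(3,4)[OF h, of A B "Suc n", folded r'_def] .
  have "xmean A B h (Suc n) = (\<integral>\<omega>. ?X \<omega> * ?P A 1 \<omega> + ?Y \<omega> * ?P B (- 1) \<omega> \<partial>M)"
    unfolding xmean_def r'_def[symmetric]
  proof (intro integral_cong_AE borel_measurable_integrable meas(1) Bochner_Integration.integrable_add X(1) Y(1))
    show "AE \<omega> in M. ?S (Suc n) \<omega> * complex_of_real (chi r' \<omega>) = ?X \<omega> * ?P A 1 \<omega> + ?Y \<omega> * ?P B (- 1) \<omega>"
      using cases by eventually_elim (auto simp: S_Suc chi_def)
  qed
  also have "\<dots> = (\<integral>\<omega>. ?X \<omega> \<partial>M) * complex_of_real (exp (- (A\<^sup>2 * h / 2)) * ((1 + 1 * e) / 2)) +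
      (\<integral>\<omega>. ?Y \<omega> \<partial>M) * complex_of_real (exp (- (B\<^sup>2 * h / 2)) * ((1 + (- 1) * e) / 2))"
    unfolding Bochner_Integration.integral_add[OF X(1) Y(1)] X(2) Y(2) r(3) e_def ..
  finally show ?x by (simp add: xmean_def ymean_def r_def mult.commute)
  have "ymean A B h (Suc n) = (\<integral>\<omega>. ?X \<omega> * ?P A (- 1) \<omega> + ?Y \<omega> * ?P B 1 \<omega> \<partial>M)"
    unfolding ymean_def r'_def[symmetric]
  proof (intro integral_cong_AE borel_measurable_integrable meas(2) Bochner_Integration.integrable_add X(1) Y(1))
    show "AE \<omega> in M. ?S (Suc n) \<omega> * complex_of_real (1 - chi r' \<omega>) = ?X \<omega> * ?P A (- 1) \<omega> + ?Y \<omega> * ?P B 1 \<omega>"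
      using cases
    proof eventually_elim
      case (elim \<omega>)
      have c: "1 - chi r' \<omega> = (1 - cos (N r' \<omega>)) / 2" by (simp add: chi_def field_simps)
      show ?case unfolding S_Suc c using elim by (auto simp: chi_def)
    qed
  qed
  also have "\<dots> = (\<integral>\<omega>. ?X \<omega> \<partial>M) * complex_of_real (exp (- (A\<^sup>2 * h / 2)) * ((1 + (- 1) * e) / 2)) +
      (\<integral>\<omega>. ?Y \<omega> \<partial>M) * complex_of_real (exp (- (B\<^sup>2 * h / 2)) * ((1 + 1 * e) / 2))"
    unfolding Bochner_Integration.integral_add[OF X(1) Y(1)] X(2) Y(2) r(3) e_def ..
  finally show ?y by (simp add: xmean_def ymean_def r_def mult.commute)
qed

end

subsection \<open>Convergence of the recursion\<close>

text \<open>A one-step error that vanishes to first order is o(1/n), so n of them still tend to 0.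
  The case t = 0 is separate because the difference quotient must avoid the point 0.\<close>

lemma scaled_tendsto_0:
  fixes f :: "real \<Rightarrow> real"
  assumes f: "(f has_real_derivative 0) (at 0)" "f 0 = 0"
  shows "(\<lambda>n. real n * \<bar>f (t / real n)\<bar>) \<longlonglongrightarrow> 0"
proof (cases "t = 0")
  case True
  then show ?thesis using f by simp
next
  case False
  have "((\<lambda>h. f h / h) \<longlongrightarrow> 0) (at 0)"
    using f by (simp add: DERIV_def)
  moreover have "filterlim (\<lambda>n. t / real n) (at 0) sequentially"
    unfolding filterlim_at
  proof
    show "(\<lambda>n. t / real n) \<longlonglongrightarrow> 0" by (rule lim_const_over_n)
    show "\<forall>\<^sub>F n in sequentially. t / real n \<in> UNIV \<and> t / real n \<noteq> 0"
      using eventually_gt_at_top[of "0::nat"] by eventually_elim (use False in simp)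
  qed
  ultimately have "(\<lambda>n. f (t / real n) / (t / real n)) \<longlonglongrightarrow> 0"
    by (rule filterlim_compose)
  from tendsto_mult_left[OF tendsto_rabs[OF this], of "\<bar>t\<bar>"]
  have "(\<lambda>n. \<bar>t\<bar> * \<bar>f (t / real n) / (t / real n)\<bar>) \<longlonglongrightarrow> 0" by simp
  moreover have "\<forall>\<^sub>F n in sequentially. \<bar>t\<bar> * \<bar>f (t / real n) / (t / real n)\<bar> = real n * \<bar>f (t / real n)\<bar>"
    using eventually_gt_at_top[of "0::nat"] by eventually_elim (use False in \<open>simp add: abs_mult abs_divide\<close>)
  ultimately show ?thesis by (rule Lim_transform_eventually)
qed

section \<open>The matrix exponential in closed form and its discretisation\<close>

locale two_state =
  fixes A B lam :: real
  assumes lam_pos: "lam > 0"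
begin

text \<open>Half the trace of R; \<open>bias\<close> is half the difference of its diagonal entries.
  Thus R = mean_rate I + K, where K has rows (bias, lam) and (lam, -bias) and K^2 = gap^2 I, so
  exp(tR) = exp(mean_rate t) (cosh(gap t) I + sinh(gap t) / gap K). The eigenvalues of R are
  mean_rate + gap and mean_rate - gap.\<close>

definition mean_rate :: real where "mean_rate = - (A\<^sup>2 + B\<^sup>2) / 4 - lam"

definition bias :: real where "bias = (B\<^sup>2 - A\<^sup>2) / 4"

definition gap :: real where "gap = sqrt (bias\<^sup>2 + lam\<^sup>2)"

text \<open>
  The entries of \<open>exp (t R)\<close> for the symmetric matrix \<open>R\<close> with rows
  \<open>(mean_rate + bias, lam)\<close> and \<open>(lam, mean_rate - bias)\<close>.
\<close>

definition e11 :: "real \<Rightarrow> real" where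
  "e11 t = exp (mean_rate * t) * (cosh (gap * t) + bias / gap * sinh (gap * t))"

definition e12 :: "real \<Rightarrow> real" where
  "e12 t = exp (mean_rate * t) * (lam / gap * sinh (gap * t))"

definition e22 :: "real \<Rightarrow> real" where
  "e22 t = exp (mean_rate * t) * (cosh (gap * t) - bias / gap * sinh (gap * t))"

text \<open>Positivity of \<open>lam\<close> keeps the divisions by \<open>gap\<close> meaningful
  even when \<open>bias\<close> is 0.\<close>

lemma gap_pos: "gap > 0"
  unfolding gap_def using lam_pos by (simp add: add_nonneg_pos)

lemma gap_square: "gap\<^sup>2 = bias\<^sup>2 + lam\<^sup>2"
  unfolding gap_def by simp

lemma e_0: "e11 0 = 1" "e12 0 = 0" "e22 0 = 1"
  by (simp_all add: e11_def e12_def e22_def)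

text \<open>The first column of exp((s + h) R) = exp(h R) exp(s R). Besides the hyperbolic addition
  formulas it uses that K / gap squares to the identity, which is \<open>pq\<close> below.\<close>

lemma e11_add: "e11 (s + h) = e11 h * e11 s + e12 h * e12 s"
  and e12_add: "e12 (s + h) = e12 h * e11 s + e22 h * e12 s"
proof -
  define p q where "p = bias / gap" and "q = lam / gap"
  have pq: "p * p + q * q = 1"
    using gap_pos gap_square lam_pos by (simp add: p_def q_def power2_eq_square flip: add_divide_distrib)
  define x y c z c' z' where defs: "x = exp (mean_rate * s)" "y = exp (mean_rate * h)"
    "c = cosh (gap * s)" "z = sinh (gap * s)" "c' = cosh (gap * h)" "z' = sinh (gap * h)"
  have E: "e11 s = x * (c + p * z)" "e12 s = x * (q * z)"
    "e11 h = y * (c' + p * z')" "e12 h = y * (q * z')" "e22 h = y * (c' - p * z')"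
    "e11 (s + h) = x * y * (c * c' + z * z' + p * (z * c' + c * z'))"
    "e12 (s + h) = x * y * (q * (z * c' + c * z'))"
    by (simp_all add: defs p_def q_def e11_def e12_def e22_def distrib_left exp_add cosh_add sinh_add)
  show "e11 (s + h) = e11 h * e11 s + e12 h * e12 s"
  proof -
    have "e11 h * e11 s + e12 h * e12 s =
        x * y * (c * c' + (p * p + q * q) * (z * z') + p * (z * c' + c * z'))"
      unfolding E by (simp add: algebra_simps)
    then show ?thesis unfolding E pq by simp
  qed
  show "e12 (s + h) = e12 h * e11 s + e22 h * e12 s"
    unfolding E by (simp add: algebra_simps)
qed

text \<open>With \<open>DERIV_e12\<close>, the first column of the equation d/dt exp(tR) = R
  exp(tR).\<close>

lemma DERIV_e11: "(e11 has_real_derivative (mean_rate + bias) * e11 t + lam * e12 t) (at t)"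
proof (rule DERIV_cong)
  show "(e11 has_real_derivative mean_rate * e11 t +
      exp (mean_rate * t) * (sinh (gap * t) * gap + bias / gap * (cosh (gap * t) * gap))) (at t)"
    unfolding e11_def[abs_def] using gap_pos by (auto intro!: derivative_eq_intros simp: field_simps)
  have gg: "bias * bias + lam * lam = gap * gap"
    using gap_square by (simp add: power2_eq_square)
  have "bias * e11 t + lam * e12 t =
      exp (mean_rate * t) * (bias * cosh (gap * t) + (bias * bias + lam * lam) / gap * sinh (gap * t))"
    by (simp add: e11_def e12_def algebra_simps add_divide_distrib)
  also have "\<dots> = exp (mean_rate * t) * (sinh (gap * t) * gap + bias / gap * (cosh (gap * t) * gap))"
    using gap_pos unfolding gg by (simp add: algebra_simps)
  finally show "mean_rate * e11 t +
      exp (mean_rate * t) * (sinh (gap * t) * gap + bias / gap * (cosh (gap * t) * gap)) =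
      (mean_rate + bias) * e11 t + lam * e12 t"
    by (simp add: distrib_right)
qed

lemma DERIV_e12: "(e12 has_real_derivative lam * e11 t + (mean_rate - bias) * e12 t) (at t)"
proof (rule DERIV_cong)
  show "(e12 has_real_derivative mean_rate * e12 t +
      exp (mean_rate * t) * (lam / gap * (cosh (gap * t) * gap))) (at t)"
    unfolding e12_def[abs_def] using gap_pos by (auto intro!: derivative_eq_intros simp: field_simps)
  show "mean_rate * e12 t + exp (mean_rate * t) * (lam / gap * (cosh (gap * t) * gap)) =
      lam * e11 t + (mean_rate - bias) * e12 t"
    using gap_pos by (simp add: e11_def e12_def field_simps)
qed

lemma DERIV_e22_0: "(e22 has_real_derivative mean_rate - bias) (at 0)"
  unfolding e22_def[abs_def] using gap_pos by (auto intro!: derivative_eq_intros)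

text \<open>
  The one-step matrix of the discretised recursion, which has the same derivative at \<open>0\<close> as
  \<open>exp (t R)\<close>.
\<close>

definition m11 :: "real \<Rightarrow> real" where
  "m11 h = exp (- (A\<^sup>2 * h / 2)) * ((1 + exp (- (2 * lam * h))) / 2)"

text \<open>The damping factor is that of the direction held before the step, so it is common to a
  column. Hence \<open>m21\<close> and \<open>m12\<close> differ, although both are compared with
  the one off-diagonal entry \<open>e12\<close>.\<close>

definition m21 :: "real \<Rightarrow> real" where
  "m21 h = exp (- (A\<^sup>2 * h / 2)) * ((1 - exp (- (2 * lam * h))) / 2)"

definition m12 :: "real \<Rightarrow> real" where
  "m12 h = exp (- (B\<^sup>2 * h / 2)) * ((1 - exp (- (2 * lam * h))) / 2)"

definition m22 :: "real \<Rightarrow> real" where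
  "m22 h = exp (- (B\<^sup>2 * h / 2)) * ((1 + exp (- (2 * lam * h))) / 2)"

lemma step_error_scaled:
  "(\<lambda>n. real n * \<bar>m11 (t / real n) - e11 (t / real n)\<bar>) \<longlonglongrightarrow> 0"
  "(\<lambda>n. real n * \<bar>m12 (t / real n) - e12 (t / real n)\<bar>) \<longlonglongrightarrow> 0"
  "(\<lambda>n. real n * \<bar>m21 (t / real n) - e12 (t / real n)\<bar>) \<longlonglongrightarrow> 0"
  "(\<lambda>n. real n * \<bar>m22 (t / real n) - e22 (t / real n)\<bar>) \<longlonglongrightarrow> 0"
proof -
  have m: "(m11 has_real_derivative mean_rate + bias) (at 0)"
    "(m12 has_real_derivative lam) (at 0)" "(m21 has_real_derivative lam) (at 0)"
    "(m22 has_real_derivative mean_rate - bias) (at 0)"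
    unfolding m11_def[abs_def] m12_def[abs_def] m21_def[abs_def] m22_def[abs_def]
    by (auto intro!: derivative_eq_intros simp: mean_rate_def bias_def field_simps)
  have e: "(e11 has_real_derivative mean_rate + bias) (at 0)"
    "(e12 has_real_derivative lam) (at 0)"
    using DERIV_e11[of 0] DERIV_e12[of 0] by (simp_all add: e_0)
  have m0: "m11 0 = 1" "m12 0 = 0" "m21 0 = 0" "m22 0 = 1"
    by (simp_all add: m11_def m12_def m21_def m22_def)
  show "(\<lambda>n. real n * \<bar>m11 (t / real n) - e11 (t / real n)\<bar>) \<longlonglongrightarrow> 0"
    using scaled_tendsto_0[of "\<lambda>h. m11 h - e11 h" t] DERIV_diff[OF m(1) e(1)] by (simp add: m0 e_0)
  show "(\<lambda>n. real n * \<bar>m12 (t / real n) - e12 (t / real n)\<bar>) \<longlonglongrightarrow> 0"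
    using scaled_tendsto_0[of "\<lambda>h. m12 h - e12 h" t] DERIV_diff[OF m(2) e(2)] by (simp add: m0 e_0)
  show "(\<lambda>n. real n * \<bar>m21 (t / real n) - e12 (t / real n)\<bar>) \<longlonglongrightarrow> 0"
    using scaled_tendsto_0[of "\<lambda>h. m21 h - e12 h" t] DERIV_diff[OF m(3) e(2)] by (simp add: m0 e_0)
  show "(\<lambda>n. real n * \<bar>m22 (t / real n) - e22 (t / real n)\<bar>) \<longlonglongrightarrow> 0"
    using scaled_tendsto_0[of "\<lambda>h. m22 h - e22 h" t] DERIV_diff[OF m(4) DERIV_e22_0] by (simp add: m0 e_0)
qed

text \<open>Stability: a nonnegative matrix with column sums at most 1 does not increase the sum of
  the absolute values of the two components. The sums are exactly the damping factors, as the two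
  parity probabilities add to 1.\<close>

lemma step_matrix_bounds:
  assumes "0 \<le> h"
  shows "0 \<le> m11 h" "0 \<le> m12 h" "0 \<le> m21 h" "0 \<le> m22 h" "m11 h + m21 h \<le> 1" "m12 h + m22 h \<le> 1"
proof -
  have e: "exp (- (2 * lam * h)) \<le> 1" using assms lam_pos by simp
  then show "0 \<le> m11 h" "0 \<le> m12 h" "0 \<le> m21 h" "0 \<le> m22 h"
    unfolding m11_def m12_def m21_def m22_def by (simp_all add: add_nonneg_nonneg)
  have "m11 h + m21 h = exp (- (A\<^sup>2 * h / 2))" "m12 h + m22 h = exp (- (B\<^sup>2 * h / 2))"
    unfolding m11_def m12_def m21_def m22_def by (simp_all add: field_simps)
  then show "m11 h + m21 h \<le> 1" "m12 h + m22 h \<le> 1" using assms by simp_all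
qed

text \<open>Stability and consistency: the one-step matrix M does not enlarge the error already
  made, and each step adds at most a bound on the exact solution times the distance of M from
  exp(hR), which is o(h).\<close>

lemma iterates_tendsto:
  fixes u v :: "nat \<Rightarrow> nat \<Rightarrow> complex"
  assumes t: "0 \<le> t"
    and init: "\<And>n. u n 0 = 1" "\<And>n. v n 0 = 0"
    and u_Suc: "\<And>n k. u n (Suc k) = of_real (m11 (t / real n)) * u n k + of_real (m12 (t / real n)) * v n k"
    and v_Suc: "\<And>n k. v n (Suc k) = of_real (m21 (t / real n)) * u n k + of_real (m22 (t / real n)) * v n k"
  shows "(\<lambda>n. u n n + v n n) \<longlonglongrightarrow> of_real (e11 t + e12 t)"
proof -
  have "continuous_on {0..t} e11" "continuous_on {0..t} e12"
    using DERIV_isCont[OF DERIV_e11] DERIV_isCont[OF DERIV_e12]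
    by (simp_all add: continuous_at_imp_continuous_on)
  then have "bounded (e11 ` {0..t} \<union> e12 ` {0..t})"
    by (simp add: compact_continuous_image compact_imp_bounded)
  then obtain K where K: "\<And>x. x \<in> e11 ` {0..t} \<union> e12 ` {0..t} \<Longrightarrow> norm x \<le> K"
    unfolding bounded_iff by blast
  \<comment> \<open>The entrywise distance between the one-step matrix and exp(hR). The error after
    k steps is at most k times \<open>K * \<eta> (t / real n)\<close>.\<close>
  define \<eta> where "\<eta> h = \<bar>m11 h - e11 h\<bar> + \<bar>m12 h - e12 h\<bar> + \<bar>m21 h - e12 h\<bar> + \<bar>m22 h - e22 h\<bar>" for h
  have err: "norm (u n k - of_real (e11 (real k * (t / real n)))) + norm (v n k - of_real (e12 (real k * (t / real n))))
      \<le> real k * (K * \<eta> (t / real n))" if "k \<le> n" for n k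
    using that
  proof (induction k)
    case 0
    then show ?case by (simp add: init e_0)
  next
    case (Suc k)
    define h where "h = t / real n"
    define s where "s = real k * h"
    have h: "0 \<le> h" using t by (simp add: h_def)
    have "real k \<le> real n" "0 < real n" using Suc.prems by auto
    then have "s \<le> t" using mult_right_mono[of "real k" "real n" h] h by (simp add: s_def h_def)
    moreover have "0 \<le> s" using h by (simp add: s_def)
    ultimately have Ks: "\<bar>e11 s\<bar> \<le> K" "\<bar>e12 s\<bar> \<le> K" using K[of "e11 s"] K[of "e12 s"] by auto
    note m = step_matrix_bounds[OF h]
    define p q where "p = u n k - of_real (e11 s)" and "q = v n k - of_real (e12 s)"
    have Suc_s: "real (Suc k) * h = s + h" by (simp add: s_def algebra_simps)
    \<comment> \<open>One row of the splitting M u - exp(hR) e = M (u - e) + (M - exp(hR)) e: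
      \<open>a\<close>, \<open>b\<close> are entries of M, \<open>p\<close>, \<open>q\<close> the
      error so far, and \<open>x\<close>, \<open>y\<close> entries of the matrix difference.\<close>
    have perturbed: "norm (of_real a * p + of_real b * q + of_real (x * e11 s + y * e12 s)) \<le>
        a * norm p + b * norm q + (\<bar>x\<bar> + \<bar>y\<bar>) * K" if "0 \<le> a" "0 \<le> b" for a b x y :: real
    proof -
      have "\<bar>x * e11 s + y * e12 s\<bar> \<le> \<bar>x\<bar> * K + \<bar>y\<bar> * K"
        using mult_left_mono[OF Ks(1), of "\<bar>x\<bar>"] mult_left_mono[OF Ks(2), of "\<bar>y\<bar>"]
          abs_triangle_ineq[of "x * e11 s" "y * e12 s"] by (simp add: abs_mult)
      moreover have "norm (of_real a * p + of_real b * q + of_real (x * e11 s + y * e12 s)) \<le>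
          norm (of_real a * p) + norm (of_real b * q) + norm (of_real (x * e11 s + y * e12 s) :: complex)"
        by (intro order_trans[OF norm_triangle_ineq] add_right_mono norm_triangle_ineq)
      moreover have "norm (of_real a * p) = a * norm p" "norm (of_real b * q) = b * norm q"
        "norm (of_real (x * e11 s + y * e12 s) :: complex) = \<bar>x * e11 s + y * e12 s\<bar>"
        using that by (simp_all only: norm_mult norm_of_real abs_of_nonneg)
      ultimately show ?thesis unfolding distrib_right by linarith
    qed
    have "u n (Suc k) - of_real (e11 (s + h)) =
        of_real (m11 h) * p + of_real (m12 h) * q + of_real ((m11 h - e11 h) * e11 s + (m12 h - e12 h) * e12 s)"
      unfolding u_Suc e11_add p_def q_def h_def[symmetric] by (simp add: algebra_simps)
    then have U: "norm (u n (Suc k) - of_real (e11 (s + h))) \<le>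
        m11 h * norm p + m12 h * norm q + (\<bar>m11 h - e11 h\<bar> + \<bar>m12 h - e12 h\<bar>) * K"
      by (simp only: perturbed[OF m(1,2)])
    have "v n (Suc k) - of_real (e12 (s + h)) =
        of_real (m21 h) * p + of_real (m22 h) * q + of_real ((m21 h - e12 h) * e11 s + (m22 h - e22 h) * e12 s)"
      unfolding v_Suc e12_add p_def q_def h_def[symmetric] by (simp add: algebra_simps)
    then have V: "norm (v n (Suc k) - of_real (e12 (s + h))) \<le>
        m21 h * norm p + m22 h * norm q + (\<bar>m21 h - e12 h\<bar> + \<bar>m22 h - e22 h\<bar>) * K"
      by (simp only: perturbed[OF m(3,4)])
    have "norm (u n (Suc k) - of_real (e11 (s + h))) + norm (v n (Suc k) - of_real (e12 (s + h))) \<le>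
        (m11 h + m21 h) * norm p + (m12 h + m22 h) * norm q + K * \<eta> h"
      using add_mono[OF U V] unfolding \<eta>_def by (simp add: algebra_simps)
    also have "\<dots> \<le> 1 * norm p + 1 * norm q + K * \<eta> h"
      using m by (intro add_right_mono add_mono mult_right_mono) auto
    also have "\<dots> \<le> real k * (K * \<eta> h) + K * \<eta> h"
      using Suc by (simp add: p_def q_def s_def h_def)
    finally show ?case unfolding h_def[symmetric] Suc_s by (simp add: algebra_simps)
  qed
  have "(\<lambda>n. K * (real n * \<eta> (t / real n))) \<longlonglongrightarrow> K * (0 + 0 + 0 + 0)"
    unfolding \<eta>_def distrib_left[of "real _"]
    by (intro tendsto_mult tendsto_const tendsto_add step_error_scaled)
  then have lim: "(\<lambda>n. K * (real n * \<eta> (t / real n))) \<longlonglongrightarrow> 0" by simp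
  have "\<forall>\<^sub>F n in sequentially. norm ((u n n + v n n) - of_real (e11 t + e12 t)) \<le> K * (real n * \<eta> (t / real n))"
    using eventually_gt_at_top[of "0::nat"]
  proof eventually_elim
    case (elim n)
    then have nt: "real n * (t / real n) = t" by simp
    have "norm ((u n n + v n n) - of_real (e11 t + e12 t)) \<le>
        norm (u n n - of_real (e11 t)) + norm (v n n - of_real (e12 t))"
      using norm_triangle_ineq[of "u n n - of_real (e11 t)" "v n n - of_real (e12 t)"]
      by (simp add: algebra_simps)
    also have "\<dots> \<le> real n * (K * \<eta> (t / real n))" using err[of n n] unfolding nt by simp
    finally show ?case by (simp add: mult_ac)
  qed
  from Lim_null_comparison[OF this lim] show ?thesis by (simp add: LIM_zero_iff)
qed

end

section \<open>The characteristic function and its differential equation\<close>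

lemma (in switched_wiener) char_switched_ito_integrals:
  assumes T: "0 \<le> T"
    and X: "has_ito_integral M past W T (\<lambda>t \<omega>. chi t \<omega> * b) X"
    and Y: "has_ito_integral M past W T (\<lambda>t \<omega>. (1 - chi t \<omega>) * b) Y"
  shows "(\<integral>\<omega>. iexp (\<alpha> * X \<omega> + \<beta> * Y \<omega>) \<partial>M) =
    of_real (two_state.e11 (\<alpha> * b) (\<beta> * b) lam T + two_state.e12 (\<alpha> * b) (\<beta> * b) lam T)"
proof -
  interpret D: two_state "\<alpha> * b" "\<beta> * b" lam by unfold_locales (rule lam_pos)
  define u where "u n = xmean (\<alpha> * b) (\<beta> * b) (T / real n)" for n
  define v where "v n = ymean (\<alpha> * b) (\<beta> * b) (T / real n)" for n
  have h: "0 \<le> T / real n" for n using T by simp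
  have "(\<lambda>n. u n n + v n n) \<longlonglongrightarrow> of_real (D.e11 T + D.e12 T)"
  proof (rule D.iterates_tendsto[of T u v, OF T])
    fix n k
    show "u n (Suc k) = of_real (D.m11 (T / real n)) * u n k + of_real (D.m12 (T / real n)) * v n k"
      unfolding u_def v_def D.m11_def D.m12_def by (rule means_Suc(1)[OF h])
    show "v n (Suc k) = of_real (D.m21 (T / real n)) * u n k + of_real (D.m22 (T / real n)) * v n k"
      unfolding u_def v_def D.m21_def D.m22_def by (rule means_Suc(2)[OF h])
  qed (simp_all add: u_def v_def means_0)
  moreover have "(\<lambda>n. u n n + v n n) \<longlonglongrightarrow> (\<integral>\<omega>. iexp (\<alpha> * X \<omega> + \<beta> * Y \<omega>) \<partial>M)"
    unfolding u_def v_def means_add[OF h] by (rule expectation_left_sum_tendsto[OF T X Y])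
  ultimately show ?thesis by (blast intro: LIMSEQ_unique)
qed

theorem theorem3:
  fixes M :: "'a measure"
    and W N x y chi :: "real \<Rightarrow> 'a \<Rightarrow> real"
    and F :: "real \<Rightarrow> 'a measure"
    and b lam \<alpha> \<beta> :: real
    and J :: "real \<Rightarrow> complex"
  assumes "prob_space M"
    and "lam > 0"
    and "wiener_process M W"
    and "poisson_process M lam (\<lambda>t \<omega>. N t \<omega> / pi)"
    and "AE \<omega> in M. N 0 \<omega> = 0"
    and "indep_processes M W N"
    and "F = natural_filtration M (\<lambda>t \<omega>. (W t \<omega>, N t \<omega>))"
    and "chi = (\<lambda>t \<omega>. (1 + cos (N t \<omega>)) / 2)"
    and "AE \<omega> in M. x 0 \<omega> = 0 \<and> y 0 \<omega> = 0"
    and "has_ito_differential M F W x (\<lambda>t \<omega>. chi t \<omega> * b)"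
    and "has_ito_differential M F W y (\<lambda>t \<omega>. (1 - chi t \<omega>) * b)"
    and "J = (\<lambda>t. \<integral>\<omega>. exp (\<i> * complex_of_real (\<alpha> * x t \<omega>) + \<i> * complex_of_real (\<beta> * y t \<omega>)) \<partial>M)"
  shows "\<exists>J' J'' :: real \<Rightarrow> complex. \<forall>t\<ge>0.
           (J has_vector_derivative J' t) (at t within {0..}) \<and>
           (J' has_vector_derivative J'' t) (at t within {0..}) \<and>
           J'' t
           + complex_of_real (1/2 * (4 * lam + (\<alpha>\<^sup>2 + \<beta>\<^sup>2) * b\<^sup>2)) * J' t
           + complex_of_real (1/2 * (lam * \<alpha>\<^sup>2 + 1/2 * \<alpha>\<^sup>2 * \<beta>\<^sup>2 * b\<^sup>2 + lam * \<beta>\<^sup>2) * b\<^sup>2) * J t = 0"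
proof -
  interpret S: switched_wiener M W N lam
    using assms(1-4,6) by (simp add: switched_wiener_def switched_wiener_axioms_def)
  interpret D: two_state "\<alpha> * b" "\<beta> * b" lam by unfold_locales (rule assms(2))
  define U V where "U = D.e11" and "V = D.e12"
  let ?p = "D.mean_rate + D.bias" and ?q = "D.mean_rate - D.bias"
  have chi: "chi = S.chi" unfolding assms(8) by (simp add: S.chi_def fun_eq_iff)
  have J_eq: "J t = of_real (U t + V t)" if t: "0 \<le> t" for t
  proof -
    have X: "has_ito_integral M S.past W t (\<lambda>t \<omega>. S.chi t \<omega> * b) (\<lambda>\<omega>. x t \<omega> - x 0 \<omega>)"
      and Y: "has_ito_integral M S.past W t (\<lambda>t \<omega>. (1 - S.chi t \<omega>) * b) (\<lambda>\<omega>. y t \<omega> - y 0 \<omega>)"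
      and [measurable]: "x t \<in> borel_measurable M" "y t \<in> borel_measurable M"
        "x 0 \<in> borel_measurable M" "y 0 \<in> borel_measurable M"
      using assms(10,11) t unfolding has_ito_differential_def assms(7) chi by auto
    \<comment> \<open>The differentials determine only the increments from time 0; the initial
      values vanish almost surely, so subtracting them leaves the expectation unchanged.\<close>
    have "J t = (\<integral>\<omega>. iexp (\<alpha> * (x t \<omega> - x 0 \<omega>) + \<beta> * (y t \<omega> - y 0 \<omega>)) \<partial>M)"
      unfolding assms(12)
    proof (rule integral_cong_AE)
      show "AE \<omega> in M. exp (\<i> * complex_of_real (\<alpha> * x t \<omega>) + \<i> * complex_of_real (\<beta> * y t \<omega>)) =
          iexp (\<alpha> * (x t \<omega> - x 0 \<omega>) + \<beta> * (y t \<omega> - y 0 \<omega>))"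
        using assms(9) by eventually_elim (simp add: distrib_left)
    qed measurable
    also have "\<dots> = of_real (U t + V t)"
      unfolding U_def V_def by (rule S.char_switched_ito_integrals[OF t X Y])
    finally show ?thesis .
  qed
  have dU: "(U has_real_derivative ?p * U t + lam * V t) (at t within {0..})"
    and dV: "(V has_real_derivative lam * U t + ?q * V t) (at t within {0..})" for t
    using D.DERIV_e11[of t] D.DERIV_e12[of t] unfolding U_def V_def
    by (auto intro: has_field_derivative_at_within)
  \<comment> \<open>The coefficients are the column sums of R: J1 and J2 are the row vector (1, 1)
    times R and times R^2, applied to (U, V).\<close>
  define J1 where "J1 t = (?p + lam) * U t + (?q + lam) * V t" for t
  define J2 where "J2 t = (?p + lam) * (?p * U t + lam * V t) + (?q + lam) * (lam * U t + ?q * V t)" for t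
  have dJ: "((\<lambda>t. U t + V t) has_real_derivative J1 t) (at t within {0..})" for t
    using DERIV_add[OF dU dV] by (rule DERIV_cong) (simp add: J1_def algebra_simps)
  have dJ1: "(J1 has_real_derivative J2 t) (at t within {0..})" for t
    unfolding J1_def[abs_def] J2_def by (intro DERIV_add DERIV_cmult dU dV)
  \<comment> \<open>With A = \<alpha> b and B = \<beta> b, the coefficient of \<open>J1\<close> is
    -tr R = 2 lam + (A^2 + B^2) / 2, and that of \<open>U t + V t\<close> is det R = A^2 B^2 / 4 +
    lam (A^2 + B^2) / 2.\<close>
  have ode: "J2 t + 1/2 * (4 * lam + (\<alpha>\<^sup>2 + \<beta>\<^sup>2) * b\<^sup>2) * J1 t +
      1/2 * (lam * \<alpha>\<^sup>2 + 1/2 * \<alpha>\<^sup>2 * \<beta>\<^sup>2 * b\<^sup>2 + lam * \<beta>\<^sup>2) * b\<^sup>2 * (U t + V t) = 0" for t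
    unfolding J1_def J2_def D.mean_rate_def D.bias_def
    by (simp add: power2_eq_square field_simps)
  show ?thesis
  proof (intro exI allI impI conjI)
    fix t :: real assume t: "t \<ge> 0"
    have "((\<lambda>t. of_real (U t + V t)) has_vector_derivative of_real (J1 t)) (at t within {0..})"
      by (rule has_vector_derivative_of_real[OF dJ])
    \<comment> \<open>The closed form is known only for nonnegative times, which suffices for the
      derivative within that half-line; at 0 it is the one-sided derivative.\<close>
    then show "(J has_vector_derivative of_real (J1 t)) (at t within {0..})"
      using t J_eq by (intro has_vector_derivative_transform[of t "{0..}" J]) auto
    show "((\<lambda>t. complex_of_real (J1 t)) has_vector_derivative of_real (J2 t)) (at t within {0..})"
      by (rule has_vector_derivative_of_real[OF dJ1])
    show "of_real (J2 t) + complex_of_real (1/2 * (4 * lam + (\<alpha>\<^sup>2 + \<beta>\<^sup>2) * b\<^sup>2)) * of_real (J1 t) +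
        complex_of_real (1/2 * (lam * \<alpha>\<^sup>2 + 1/2 * \<alpha>\<^sup>2 * \<beta>\<^sup>2 * b\<^sup>2 + lam * \<beta>\<^sup>2) * b\<^sup>2) * J t = 0"
      unfolding J_eq[OF t] of_real_mult[symmetric] of_real_add[symmetric] ode by simp
  qed
qed

end
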